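(* Let $f:\subseteq X\rightrightarrows Y$ be a problem. Then: (1) $\mathrm{DIS}\le_{\mathrm W} f$ if and only if $f$ is computably discontinuous; (2) $\mathrm{DIS}\le_{\mathrm W}^* f$ if and only if $f$ is effectively discontinuous. Moreover, in both statements one may replace $\le_{\mathrm W}$ by $\le_{\mathrm{sW}}$ and $\le_{\mathrm W}^*$ by $\le_{\mathrm{sW}}^*$, respectively.
   Context: Work in ZF + dependent choice. A represented space is a pair $(X,\delta_X)$ with $\delta_X:\subseteq\mathbb{N}^\mathbb{N}\to X$ a partial surjection. A problem $f:\subseteq X\rightrightarrows Y$ is a partial multivalued function between represented spaces that has a realizer, i.e. a function $F:\subseteq\mathbb{N}^\mathbb{N}\to\mathbb{N}^\mathbb{N}$ with $\delta_Y F(p)\in f(\delta_X(p))$ for all $p\in\mathrm{dom}(f\circ\delta_X)$. Pairing on Baire space: $\langle p,q\rangle(2n)=p(n)$, $\langle p,q\rangle(2n+1)=q(n)$. $\Phi$ is the standard total representation of continuous partial functions on Baire space (Weihrauch): for each $q\in\mathbb{N}^\mathbb{N}$, $\Phi_q:\subseteq\mathbb{N}^\mathbb{N}\to\mathbb{N}^\mathbb{N}$ is the continuous function $p\mapsto\sup_{w\sqsubseteq p}h(w)$ (defined where this is infinite) for the monotone word function $h:\mathbb{N}^*\to\mathbb{N}^*$ whose graph is listed by $q$ (inconsistent $q$ name the nowhere defined function); every continuous partial function on Baire space has an extension of the form $\Phi_q$, and the smn theorem holds. The universal function is the computable map $\mathrm{U}:\subseteq\mathbb{N}^\mathbb{N}\to\mathbb{N}^\mathbb{N}$,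 $\mathrm{U}\langle q,p\rangle:=\Phi_q(p)$. The discontinuity problem is $\mathrm{DIS}:\mathbb{N}^\mathbb{N}\rightrightarrows\mathbb{N}^\mathbb{N}$, $\mathrm{DIS}(p):=\{q\in\mathbb{N}^\mathbb{N}:\mathrm{U}(p)\ne q\}$ (so if $p\notin\mathrm{dom}(\mathrm U)$ every $q$ is a solution). For problems $f:\subseteq X\rightrightarrows Y$, $g:\subseteq W\rightrightarrows Z$: $f\le_{\mathrm W} g$ if there are computable $H,K:\subseteq\mathbb{N}^\mathbb{N}\to\mathbb{N}^\mathbb{N}$ such that $p\mapsto H\langle p,GK(p)\rangle$ is a realizer of $f$ whenever $G$ is a realizer of $g$; $f\le_{\mathrm{sW}} g$ if instead $HGK$ is a realizer of $f$ for every realizer $G$ of $g$; $\le_{\mathrm W}^*$ and $\le_{\mathrm{sW}}^*$ are the same notions with $H,K$ only required to be continuous. A problem $f:\subseteq X\rightrightarrows Y$ is computably discontinuous (effectively discontinuous) if there is a computable (continuous) total $D:\mathbb{N}^\mathbb{N}\to\mathbb{N}^\mathbb{N}$ such that for all $q\in\mathbb{N}^\mathbb{N}$: $D(q)\in\mathrm{dom}(f\circ\delta_X)$ and $\delta_Y\Phi_qD(q)\notin f\delta_XD(q)$, where the latter condition counts as satisfied if $\delta_Y\Phi_qD(q)$ is undefined. *)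

theory Defs
  imports "HOL-Analysis.Function_Topology" "HOL-Library.Nat_Bijection" "HOL-Library.Sublist"
begin

type_synonym baire = "nat \<Rightarrow> nat"

text \<open>Partial recursive functions of Kleene, as a big-step evaluation relation on argument lists.
  In \<open>PrimRec\<close> and \<open>Mu\<close> the recursion, resp. search, variable is the first argument.\<close>

datatype recf = Zero | Succ | Proj nat | Comp recf "recf list" | PrimRec recf recf | Mu recf

inductive rec_eval :: "recf \<Rightarrow> nat list \<Rightarrow> nat \<Rightarrow> bool" where
  Zero: "rec_eval Zero xs 0"
| Succ: "rec_eval Succ [x] (Suc x)"
| Proj: "i < length xs \<Longrightarrow> rec_eval (Proj i) xs (xs ! i)"
| Comp: "length ys = length gs \<Longrightarrow> (\<And>i. i < length gs \<Longrightarrow> rec_eval (gs ! i) xs (ys ! i)) \<Longrightarrow>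
    rec_eval f ys z \<Longrightarrow> rec_eval (Comp f gs) xs z"
| PrimRec_0: "rec_eval f xs y \<Longrightarrow> rec_eval (PrimRec f g) (0 # xs) y"
| PrimRec_Suc: "rec_eval (PrimRec f g) (n # xs) y \<Longrightarrow> rec_eval g (n # y # xs) z \<Longrightarrow>
    rec_eval (PrimRec f g) (Suc n # xs) z"
| Mu: "rec_eval f (n # xs) 0 \<Longrightarrow> (\<And>m. m < n \<Longrightarrow> \<exists>y. rec_eval f (m # xs) (Suc y)) \<Longrightarrow>
    rec_eval (Mu f) xs n"

inductive_cases rec_eval_ZeroE: "rec_eval Zero xs y"
inductive_cases rec_eval_SuccE: "rec_eval Succ xs y"
inductive_cases rec_eval_ProjE: "rec_eval (Proj i) xs y"
inductive_cases rec_eval_CompE: "rec_eval (Comp f gs) xs y"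
inductive_cases rec_eval_PrimRec_0E: "rec_eval (PrimRec f g) (0 # xs) y"
inductive_cases rec_eval_PrimRec_SucE: "rec_eval (PrimRec f g) (Suc n # xs) y"
inductive_cases rec_eval_MuE: "rec_eval (Mu f) xs y"

lemma rec_eval_deterministic: "rec_eval e xs y \<Longrightarrow> rec_eval e xs z \<Longrightarrow> y = z"
proof (induction arbitrary: z rule: rec_eval.induct)
  case (Comp ys gs xs f y)
  from Comp.prems obtain zs where zs: "length zs = length gs"
    "\<And>i. i < length gs \<Longrightarrow> rec_eval (gs ! i) xs (zs ! i)" "rec_eval f zs z"
    by (auto elim: rec_eval_CompE)
  have "ys = zs"
    using Comp.hyps(1) Comp.IH(1) zs(1,2) by (intro nth_equalityI) auto
  then show ?case using Comp.IH(2) zs(3) by blast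
next
  case (Mu f n xs)
  from Mu.prems have z: "rec_eval f (z # xs) 0"
    "\<And>m. m < z \<Longrightarrow> \<exists>y. rec_eval f (m # xs) (Suc y)"
    by (auto elim: rec_eval_MuE)
  show ?case
  proof (rule linorder_cases[of n z])
    assume "n < z"
    then show ?thesis using z(2) Mu.IH(1) by blast
  next
    assume "z < n"
    then show ?thesis using z(1) Mu.IH(2) by blast
  qed
next
  case (PrimRec_Suc f g n xs y z')
  then show ?case by (blast elim: rec_eval_PrimRec_SucE)
qed (blast elim: rec_eval_ZeroE rec_eval_SuccE rec_eval_ProjE rec_eval_PrimRec_0E)+

definition total_recursive :: "(nat \<Rightarrow> nat) \<Rightarrow> bool" where
  "total_recursive f \<longleftrightarrow> (\<exists>e. \<forall>n. rec_eval e [n] (f n))"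

definition computable_word_fun :: "(nat list \<Rightarrow> nat list) \<Rightarrow> bool" where
  "computable_word_fun h \<longleftrightarrow> total_recursive (\<lambda>n. list_encode (h (list_decode n)))"

definition monotone_word_fun :: "(nat list \<Rightarrow> nat list) \<Rightarrow> bool" where
  "monotone_word_fun h \<longleftrightarrow> monotone prefix prefix h"

definition initial :: "nat list \<Rightarrow> baire \<Rightarrow> bool" (infix "\<sqsubset>\<^sub>B" 50) where
  "w \<sqsubset>\<^sub>B p \<longleftrightarrow> w = map p [0..<length w]"

text \<open>For monotone \<open>h\<close> the words \<open>h w\<close> with \<open>w\<close> an initial segment of \<open>p\<close> form a chain; its
  supremum is infinite iff their lengths are unbounded, and then it is the only sequence having
  all of them as initial segments.\<close>

definition word_fun_sup :: "(nat list \<Rightarrow> nat list) \<Rightarrow> baire \<rightharpoonup> baire" where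
  "word_fun_sup h p =
    (if \<forall>n. \<exists>w. w \<sqsubset>\<^sub>B p \<and> n \<le> length (h w)
     then Some (THE r. \<forall>w. w \<sqsubset>\<^sub>B p \<longrightarrow> h w \<sqsubset>\<^sub>B r) else None)"

text \<open>Computability and continuity of a partial function are read on its domain: a computable
  function is one that has an extension of the form \<open>word_fun_sup h\<close> with computable \<open>h\<close>.\<close>

definition computable_fun :: "(baire \<rightharpoonup> baire) \<Rightarrow> bool" where
  "computable_fun F \<longleftrightarrow> (\<exists>h. monotone_word_fun h \<and> computable_word_fun h \<and>
     (\<forall>p\<in>dom F. F p = word_fun_sup h p))"

definition continuous_fun :: "(baire \<rightharpoonup> baire) \<Rightarrow> bool" where
  "continuous_fun F \<longleftrightarrow> continuous_on (dom F) (\<lambda>p. the (F p))"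

definition lists_graph :: "baire \<Rightarrow> (nat list \<Rightarrow> nat list) \<Rightarrow> bool" where
  "lists_graph q h \<longleftrightarrow> range q = range (\<lambda>w. prod_encode (list_encode w, list_encode (h w)))"

lemma lists_graph_unique:
  assumes "lists_graph q h" "lists_graph q h'"
  shows "h = h'"
proof
  fix w
  have "prod_encode (list_encode w, list_encode (h w)) \<in>
      range (\<lambda>w. prod_encode (list_encode w, list_encode (h' w)))"
    using assms unfolding lists_graph_def by blast
  then show "h w = h' w" by (auto simp: list_encode_eq)
qed

definition Phi :: "baire \<Rightarrow> baire \<rightharpoonup> baire" where
  "Phi q p =
    (if \<exists>h. monotone_word_fun h \<and> lists_graph q h
     then word_fun_sup (THE h. lists_graph q h) p else None)"

definition bpair :: "baire \<Rightarrow> baire \<Rightarrow> baire" where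
  "bpair p q n = (if even n then p (n div 2) else q (n div 2))"

definition bfst :: "baire \<Rightarrow> baire" where "bfst r n = r (2 * n)"

definition bsnd :: "baire \<Rightarrow> baire" where "bsnd r n = r (2 * n + 1)"

lemma bpair_inverse [simp]: "bfst (bpair p q) = p" "bsnd (bpair p q) = q" "bpair (bfst r) (bsnd r) = r"
  by (auto simp: fun_eq_iff bfst_def bsnd_def bpair_def elim: oddE)

definition U :: "baire \<rightharpoonup> baire" where
  "U r = Phi (bfst r) (bsnd r)"

text \<open>A multivalued partial function \<open>f\<close> is given by its value sets; its domain is the set of
  points with nonempty value.\<close>

definition mv_dom :: "('x \<Rightarrow> 'y set) \<Rightarrow> 'x set" where
  "mv_dom f = {x. f x \<noteq> {}}"

definition represented_space :: "'x set \<Rightarrow> (baire \<rightharpoonup> 'x) \<Rightarrow> bool" where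
  "represented_space X \<delta> \<longleftrightarrow> ran \<delta> = X"

definition realizer ::
  "(baire \<rightharpoonup> 'x) \<Rightarrow> (baire \<rightharpoonup> 'y) \<Rightarrow> ('x \<Rightarrow> 'y set) \<Rightarrow> (baire \<rightharpoonup> baire) \<Rightarrow> bool" where
  "realizer \<delta>X \<delta>Y f F \<longleftrightarrow>
    (\<forall>p x. \<delta>X p = Some x \<and> x \<in> mv_dom f \<longrightarrow> (\<exists>y. (\<delta>Y \<circ>\<^sub>m F) p = Some y \<and> y \<in> f x))"

definition problem ::
  "'x set \<Rightarrow> (baire \<rightharpoonup> 'x) \<Rightarrow> 'y set \<Rightarrow> (baire \<rightharpoonup> 'y) \<Rightarrow> ('x \<Rightarrow> 'y set) \<Rightarrow> bool" where
  "problem X \<delta>X Y \<delta>Y f \<longleftrightarrow>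
    represented_space X \<delta>X \<and> represented_space Y \<delta>Y \<and>
    mv_dom f \<subseteq> X \<and> (\<forall>x. f x \<subseteq> Y) \<and> (\<exists>F. realizer \<delta>X \<delta>Y f F)"

text \<open>Baire space itself is represented by the identity, i.e. by \<open>Some\<close>.\<close>

definition DIS :: "baire \<Rightarrow> baire set" where
  "DIS p = {q. U p \<noteq> Some q}"

lemma problem_DIS: "problem UNIV Some UNIV Some DIS"
proof -
  have "\<exists>q. U p \<noteq> Some q" for p
  proof (rule ccontr)
    assume "\<not> ?thesis"
    then have "U p = Some (\<lambda>_. 0)" "U p = Some (\<lambda>_. 1)" by auto
    then have "(\<lambda>_::nat. 0::nat) = (\<lambda>_. 1)" by simp
    then show False by (auto dest: fun_cong)
  qed
  then obtain F where "\<And>p. U p \<noteq> Some (F p)" by metis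
  then have "realizer Some Some DIS (\<lambda>p. Some (F p))"
    by (auto simp: realizer_def DIS_def map_comp_def)
  then show ?thesis
    by (auto simp: problem_def represented_space_def ran_def)
qed

text \<open>In each reducibility the arguments are the two representations and the multivalued function
  of the left-hand problem, followed by those of the right-hand problem.  The class \<open>\<C>\<close> of
  admissible \<open>H\<close> and \<open>K\<close> is that of the computable, resp. continuous, partial functions.\<close>

definition W_reducible_in :: "((baire \<rightharpoonup> baire) \<Rightarrow> bool) \<Rightarrow>
    (baire \<rightharpoonup> 'x) \<Rightarrow> (baire \<rightharpoonup> 'y) \<Rightarrow> ('x \<Rightarrow> 'y set) \<Rightarrow>
    (baire \<rightharpoonup> 'w) \<Rightarrow> (baire \<rightharpoonup> 'z) \<Rightarrow> ('w \<Rightarrow> 'z set) \<Rightarrow> bool" where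
  "W_reducible_in \<C> \<delta>X \<delta>Y f \<delta>W \<delta>Z g \<longleftrightarrow>
    (\<exists>H K. \<C> H \<and> \<C> K \<and> (\<forall>G. realizer \<delta>W \<delta>Z g G \<longrightarrow>
      realizer \<delta>X \<delta>Y f (\<lambda>p. Option.bind ((G \<circ>\<^sub>m K) p) (\<lambda>r. H (bpair p r)))))"

definition sW_reducible_in :: "((baire \<rightharpoonup> baire) \<Rightarrow> bool) \<Rightarrow>
    (baire \<rightharpoonup> 'x) \<Rightarrow> (baire \<rightharpoonup> 'y) \<Rightarrow> ('x \<Rightarrow> 'y set) \<Rightarrow>
    (baire \<rightharpoonup> 'w) \<Rightarrow> (baire \<rightharpoonup> 'z) \<Rightarrow> ('w \<Rightarrow> 'z set) \<Rightarrow> bool" where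
  "sW_reducible_in \<C> \<delta>X \<delta>Y f \<delta>W \<delta>Z g \<longleftrightarrow>
    (\<exists>H K. \<C> H \<and> \<C> K \<and> (\<forall>G. realizer \<delta>W \<delta>Z g G \<longrightarrow>
      realizer \<delta>X \<delta>Y f (H \<circ>\<^sub>m G \<circ>\<^sub>m K)))"

abbreviation "W_reducible \<equiv> W_reducible_in computable_fun"
abbreviation "sW_reducible \<equiv> sW_reducible_in computable_fun"
abbreviation "W_reducible_cont \<equiv> W_reducible_in continuous_fun"
abbreviation "sW_reducible_cont \<equiv> sW_reducible_in continuous_fun"

definition discontinuous_in :: "((baire \<rightharpoonup> baire) \<Rightarrow> bool) \<Rightarrow>
    (baire \<rightharpoonup> 'x) \<Rightarrow> (baire \<rightharpoonup> 'y) \<Rightarrow> ('x \<Rightarrow> 'y set) \<Rightarrow> bool" where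
  "discontinuous_in \<C> \<delta>X \<delta>Y f \<longleftrightarrow>
    (\<exists>D :: baire \<Rightarrow> baire. \<C> (\<lambda>q. Some (D q)) \<and>
      (\<forall>q. \<exists>x. \<delta>X (D q) = Some x \<and> x \<in> mv_dom f \<and>
        (\<forall>y. (\<delta>Y \<circ>\<^sub>m Phi q) (D q) = Some y \<longrightarrow> y \<notin> f x)))"

abbreviation "computably_discontinuous \<equiv> discontinuous_in computable_fun"
abbreviation "effectively_discontinuous \<equiv> discontinuous_in continuous_fun"

end

theory Submission
  imports Defs
begin

text \<open>If \<open>D\<close> witnesses the discontinuity of \<open>f\<close>, let \<open>s p\<close> be an index of the constant function with
  value \<open>U p\<close>.  A realizer \<open>G\<close> of \<open>f\<close> cannot return \<open>U p = Phi (s p) (D (s p))\<close> on \<open>D (s p)\<close>, so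
  \<open>G \<circ> D \<circ> s\<close> realizes DIS and the reduction is even strong.  Conversely, if \<open>H\<close> and \<open>K\<close> reduce DIS to
  \<open>f\<close>, the recursion theorem yields an index \<open>a\<close> with \<open>Phi a q = H \<langle>\<langle>a, q\<rangle>, Phi q (K \<langle>a, q\<rangle>)\<rangle>\<close>
  for all \<open>q\<close>.  Were \<open>Phi q (K \<langle>a, q\<rangle>)\<close> a correct answer, some realizer would return it, and
  the reduction would solve DIS at \<open>\<langle>a, q\<rangle>\<close> by the forbidden value \<open>U \<langle>a, q\<rangle> = Phi a q\<close>.  Hence
  \<open>D q = K \<langle>a, q\<rangle>\<close> is a witness of discontinuity.

  The index \<open>a\<close> must list a monotone word function even though most \<open>q\<close> are inconsistent; for this
  reason its approximations ignore every value that does not extend the previous output.\<close>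

section \<open>Recursive functions on coded types\<close>

definition recursive_list :: "nat \<Rightarrow> (nat list \<Rightarrow> nat) \<Rightarrow> bool" where
  "recursive_list n F \<longleftrightarrow> (\<exists>e. \<forall>xs. length xs = n \<longrightarrow> rec_eval e xs (F xs))"

lemma recursive_list_cong:
  "recursive_list n F \<Longrightarrow> (\<And>xs. length xs = n \<Longrightarrow> F xs = G xs) \<Longrightarrow> recursive_list n G"
  unfolding recursive_list_def by metis

lemma recursive_list_nth: "i < n \<Longrightarrow> recursive_list n (\<lambda>xs. xs ! i)"
  unfolding recursive_list_def using rec_eval.Proj by metis

lemma recursive_list_0: "recursive_list n (\<lambda>xs. 0)"
  unfolding recursive_list_def using rec_eval.Zero by metis

lemma recursive_list_comp:
  assumes G: "recursive_list (length Fs) G" and Fs: "\<And>F. F \<in> set Fs \<Longrightarrow> recursive_list n F"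
  shows "recursive_list n (\<lambda>xs. G (map (\<lambda>F. F xs) Fs))"
proof -
  obtain e where e: "\<And>xs. length xs = length Fs \<Longrightarrow> rec_eval e xs (G xs)"
    using G unfolding recursive_list_def by blast
  obtain E where E: "\<And>F xs. F \<in> set Fs \<Longrightarrow> length xs = n \<Longrightarrow> rec_eval (E F) xs (F xs)"
    using Fs unfolding recursive_list_def by metis
  have "rec_eval (Comp e (map E Fs)) xs (G (map (\<lambda>F. F xs) Fs))" if "length xs = n" for xs
    by (rule rec_eval.Comp[where ys = "map (\<lambda>F. F xs) Fs"]) (use that e E in auto)
  then show ?thesis unfolding recursive_list_def by blast
qed

lemma recursive_list_comp1:
  assumes "recursive_list 1 (\<lambda>xs. g (xs ! 0))" "recursive_list n F"
  shows "recursive_list n (\<lambda>xs. g (F xs))"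
  using recursive_list_comp[of "[F]" "\<lambda>xs. g (xs ! 0)" n] assms by simp

lemma recursive_list_comp2:
  assumes "recursive_list 2 (\<lambda>xs. g (xs ! 0) (xs ! 1))" "recursive_list n F" "recursive_list n F'"
  shows "recursive_list n (\<lambda>xs. g (F xs) (F' xs))"
  using recursive_list_comp[of "[F, F']" "\<lambda>xs. g (xs ! 0) (xs ! 1)" n] assms
  by (auto simp: numeral_2_eq_2)

lemma recursive_list_Suc: "recursive_list n F \<Longrightarrow> recursive_list n (\<lambda>xs. Suc (F xs))"
proof (erule recursive_list_comp1[rotated])
  have "rec_eval Succ xs (Suc (xs ! 0))" if "length xs = 1" for xs
    using that rec_eval.Succ[of "xs ! 0"] by (cases xs) auto
  then show "recursive_list 1 (\<lambda>xs. Suc (xs ! 0))"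
    unfolding recursive_list_def by blast
qed

lemma recursive_list_primrec:
  assumes "recursive_list n F" "recursive_list (n + 2) G"
  shows "recursive_list (Suc n) (\<lambda>xs. rec_nat (F (tl xs)) (\<lambda>k y. G (k # y # tl xs)) (hd xs))"
proof -
  obtain e where e: "\<And>xs. length xs = n \<Longrightarrow> rec_eval e xs (F xs)"
    using assms unfolding recursive_list_def by blast
  obtain e' where e': "\<And>xs. length xs = n + 2 \<Longrightarrow> rec_eval e' xs (G xs)"
    using assms unfolding recursive_list_def by blast
  have "rec_eval (PrimRec e e') (m # xs) (rec_nat (F xs) (\<lambda>k y. G (k # y # xs)) m)"
    if "length xs = n" for m xs
    using that by (induction m) (auto intro!: rec_eval.PrimRec_0 rec_eval.PrimRec_Suc e e')
  then have "rec_eval (PrimRec e e') xs (rec_nat (F (tl xs)) (\<lambda>k y. G (k # y # tl xs)) (hd xs))"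
    if "length xs = Suc n" for xs
    using that by (cases xs) auto
  then show ?thesis unfolding recursive_list_def by blast
qed

text \<open>Projections pass the arguments \<open>xs\<close> on as parameters, so the number of
  steps may be any recursive function of \<open>xs\<close> instead of the first argument.\<close>

lemma recursive_list_rec_nat:
  assumes F: "recursive_list n F" and N: "recursive_list n N"
    and G: "recursive_list (n + 2) (\<lambda>ys. G (ys ! 0) (ys ! 1) (drop 2 ys))"
  shows "recursive_list n (\<lambda>xs. rec_nat (F xs) (\<lambda>k y. G k y xs) (N xs))"
proof -
  let ?Fs = "N # map (\<lambda>i xs. xs ! i) [0..<n]"
  have "recursive_list n (\<lambda>xs. (\<lambda>xs. rec_nat (F (tl xs)) (\<lambda>k y. G k y (tl xs)) (hd xs))
      (map (\<lambda>F. F xs) ?Fs))"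
    by (rule recursive_list_comp)
      (use recursive_list_primrec[OF F G] N in \<open>auto intro: recursive_list_nth\<close>)
  moreover have "map (\<lambda>F. F xs) ?Fs = N xs # xs" if "length xs = n" for xs
    using that map_nth[of xs] by (simp add: comp_def)
  ultimately show ?thesis
    by (auto elim: recursive_list_cong simp del: list.map)
qed

section \<open>Arithmetic and the Cantor pairing\<close>

lemma recursive_list_add: "recursive_list 2 (\<lambda>xs. xs ! 0 + xs ! 1)"
proof -
  have "recursive_list 2 (\<lambda>xs. rec_nat (xs ! 1) (\<lambda>k y. Suc y) (xs ! 0))"
    by (intro recursive_list_rec_nat recursive_list_Suc recursive_list_nth) auto
  moreover have "rec_nat b (\<lambda>k y. Suc y) a = a + b" for a b by (induction a) auto
  ultimately show ?thesis by simp
qed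

lemma recursive_list_pred: "recursive_list 1 (\<lambda>xs. xs ! 0 - 1)"
proof -
  have "recursive_list 1 (\<lambda>xs. rec_nat 0 (\<lambda>k y. k) (xs ! 0))"
    by (intro recursive_list_rec_nat recursive_list_0 recursive_list_nth) auto
  moreover have "rec_nat 0 (\<lambda>k y. k) a = a - 1" for a by (cases a) auto
  ultimately show ?thesis by simp
qed

lemma recursive_list_diff: "recursive_list 2 (\<lambda>xs. xs ! 0 - xs ! 1)"
proof -
  have "recursive_list 2 (\<lambda>xs. rec_nat (xs ! 0) (\<lambda>k y. y - 1) (xs ! 1))"
    by (intro recursive_list_rec_nat recursive_list_nth recursive_list_comp1[OF recursive_list_pred]) auto
  moreover have "rec_nat a (\<lambda>k y. y - 1) b = a - b" for a b by (induction b) auto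
  ultimately show ?thesis by simp
qed

text \<open>The two truncated differences add up to 0 exactly when \<open>A\<close> and
  \<open>B\<close> agree; a recursion of that length whose step always returns \<open>G\<close>
  makes the case distinction.\<close>

lemma recursive_list_if:
  assumes "recursive_list n A" "recursive_list n B" "recursive_list n F" "recursive_list n G"
  shows "recursive_list n (\<lambda>xs. if A xs = B xs then F xs else G xs)"
proof -
  have "recursive_list n (\<lambda>xs. rec_nat (F xs) (\<lambda>k y. G xs) ((A xs - B xs) + (B xs - A xs)))"
  proof (intro recursive_list_rec_nat assms recursive_list_comp2[OF recursive_list_add]
      recursive_list_comp2[OF recursive_list_diff])
    show "recursive_list (n + 2) (\<lambda>ys. G (drop 2 ys))"
      by (rule recursive_list_cong[OF recursive_list_comp[of "map (\<lambda>i ys. ys ! (i + 2)) [0..<n]" G]])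
        (use assms(4) in \<open>auto intro!: recursive_list_nth arg_cong[where f = G] nth_equalityI
          simp: add.commute\<close>)
  qed
  moreover have "rec_nat a (\<lambda>k y. b) m = (if m = 0 then a else b)" for a b :: nat and m
    by (cases m) auto
  ultimately show ?thesis by (auto intro: recursive_list_cong)
qed

lemma recursive_list_triangle: "recursive_list 1 (\<lambda>xs. triangle (xs ! 0))"
proof -
  have "recursive_list 1 (\<lambda>xs. rec_nat 0 (\<lambda>k y. y + Suc k) (xs ! 0))"
    by (intro recursive_list_rec_nat recursive_list_0 recursive_list_nth recursive_list_Suc
        recursive_list_comp2[OF recursive_list_add]) auto
  moreover have "rec_nat 0 (\<lambda>k y. y + Suc k) a = triangle a" for a by (induction a) auto
  ultimately show ?thesis by simp
qed

lemma recursive_list_prod_encode: "recursive_list 2 (\<lambda>xs. prod_encode (xs ! 0, xs ! 1))"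
  unfolding prod_encode_def prod.case
  by (intro recursive_list_comp2[OF recursive_list_add] recursive_list_comp1[OF recursive_list_triangle]
      recursive_list_nth) auto

text \<open>The sum of the two components of \<open>prod_decode n\<close>; it is the index of the largest triangle
  number up to \<open>n\<close>, which can be tracked without already having pairs at hand.\<close>

definition diagonal :: "nat \<Rightarrow> nat" where
  "diagonal n = rec_nat 0 (\<lambda>k s. if Suc k = triangle (Suc s) then Suc s else s) n"

lemma diagonal_bounds: "triangle (diagonal n) \<le> n \<and> n < triangle (Suc (diagonal n))"
  by (induction n) (auto simp: diagonal_def)

text \<open>The intervals between consecutive triangle numbers are disjoint, and both
  \<open>a + b\<close> and \<open>diagonal\<close> index the one that contains the code.\<close>

lemma diagonal_prod_encode: "diagonal (prod_encode (a, b)) = a + b"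
proof -
  have mono: "triangle m \<le> triangle n" if "m \<le> n" for m n
    using that by (induction rule: dec_induct) auto
  let ?n = "prod_encode (a, b)" and ?d = "diagonal (prod_encode (a, b))"
  have "triangle (a + b) \<le> ?n" "?n < triangle (Suc (a + b))"
    by (auto simp: prod_encode_def)
  then have "\<not> Suc (a + b) \<le> ?d" "\<not> Suc ?d \<le> a + b"
    using diagonal_bounds[of ?n] mono[of "Suc (a + b)" ?d] mono[of "Suc ?d" "a + b"] by linarith+
  then show ?thesis by linarith
qed

lemma recursive_list_diagonal: "recursive_list 1 (\<lambda>xs. diagonal (xs ! 0))"
  unfolding diagonal_def
  by (intro recursive_list_rec_nat recursive_list_0 recursive_list_nth recursive_list_Suc
      recursive_list_if recursive_list_comp1[OF recursive_list_triangle]) auto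

lemma recursive_list_fst_prod_decode: "recursive_list 1 (\<lambda>xs. fst (prod_decode (xs ! 0)))"
proof -
  have "recursive_list 1 (\<lambda>xs. xs ! 0 - triangle (diagonal (xs ! 0)))"
    by (intro recursive_list_comp2[OF recursive_list_diff] recursive_list_diagonal
        recursive_list_comp1[OF recursive_list_triangle] recursive_list_nth) auto
  moreover have "n - triangle (diagonal n) = fst (prod_decode n)" for n
  proof -
    obtain a b where "n = prod_encode (a, b)" by (metis prod_decode_inverse surj_pair)
    then show ?thesis by (simp add: diagonal_prod_encode) (simp add: prod_encode_def)
  qed
  ultimately show ?thesis by simp
qed

lemma recursive_list_snd_prod_decode: "recursive_list 1 (\<lambda>xs. snd (prod_decode (xs ! 0)))"
proof -
  have "recursive_list 1 (\<lambda>xs. diagonal (xs ! 0) - fst (prod_decode (xs ! 0)))"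
    by (intro recursive_list_comp2[OF recursive_list_diff] recursive_list_diagonal
        recursive_list_fst_prod_decode)
  moreover have "diagonal n - fst (prod_decode n) = snd (prod_decode n)" for n
  proof -
    obtain a b where "n = prod_encode (a, b)" by (metis prod_decode_inverse surj_pair)
    then show ?thesis by (simp add: diagonal_prod_encode)
  qed
  ultimately show ?thesis by simp
qed

section \<open>Types with codes in the natural numbers\<close>

class coded =
  fixes enc :: "'a \<Rightarrow> nat"
  assumes enc_inject: "enc x = enc y \<longleftrightarrow> x = y"

instantiation nat :: coded
begin
definition enc_nat :: "nat \<Rightarrow> nat" where [simp]: "enc_nat n = n"
instance by standard simp
end

instantiation bool :: coded
begin
definition enc_bool :: "bool \<Rightarrow> nat" where [simp]: "enc_bool b = of_bool b"
instance by standard simp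
end

instantiation prod :: (coded, coded) coded
begin
definition enc_prod :: "'a \<times> 'b \<Rightarrow> nat" where
  "enc_prod z = prod_encode (enc (fst z), enc (snd z))"
instance by standard (auto simp: enc_prod_def enc_inject)
end

instantiation list :: (coded) coded
begin
definition enc_list :: "'a list \<Rightarrow> nat" where "enc_list xs = list_encode (map enc xs)"
instance by standard (auto simp: enc_list_def list_encode_eq enc_inject inj_def)
end

lemma enc_nat_list: "enc (xs :: nat list) = list_encode xs"
  by (simp add: enc_list_def map_idI)

text \<open>The program is constrained on codes only. On word functions this is
  \<open>computable_word_fun\<close>, while pairs and truth values become available for intermediate
  results.\<close>

definition recursive :: "('a :: coded \<Rightarrow> 'b :: coded) \<Rightarrow> bool" where
  "recursive f \<longleftrightarrow> (\<exists>e. \<forall>x. rec_eval e [enc x] (enc (f x)))"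

lemma recursiveI:
  assumes "recursive_list 1 (\<lambda>xs. g (xs ! 0))" "\<And>x. enc (f x) = g (enc x)"
  shows "recursive f"
proof -
  obtain e where "\<And>xs. length xs = 1 \<Longrightarrow> rec_eval e xs (g (xs ! 0))"
    using assms(1) unfolding recursive_list_def by blast
  from this[of "[enc _]"] show ?thesis
    unfolding recursive_def assms(2) by auto
qed

lemma computable_word_fun_iff_recursive: "computable_word_fun h \<longleftrightarrow> recursive h"
  unfolding computable_word_fun_def total_recursive_def recursive_def enc_nat_list
  by (metis list_decode_inverse list_encode_inverse)

named_theorems recursive_intros

lemma recursive_ident [recursive_intros]: "recursive (\<lambda>x. x)"
  by (rule recursiveI[where g = "\<lambda>n. n"]) (auto intro: recursive_list_nth)

lemma recursive_comp:
  assumes "recursive f" "recursive g"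
  shows "recursive (\<lambda>x. f (g x))"
proof -
  obtain e e' where e: "\<And>x. rec_eval e [enc x] (enc (f x))" "\<And>x. rec_eval e' [enc x] (enc (g x))"
    using assms unfolding recursive_def by blast
  have "rec_eval (Comp e [e']) [enc x] (enc (f (g x)))" for x
    by (rule rec_eval.Comp[where ys = "[enc (g x)]"]) (auto intro: e)
  then show ?thesis unfolding recursive_def by blast
qed

lemma recursive_const [recursive_intros]: "recursive (\<lambda>x. c)"
proof -
  have "recursive_list 1 (\<lambda>xs. n)" for n
    by (induction n) (auto intro: recursive_list_0 recursive_list_Suc)
  then show ?thesis by (rule recursiveI) simp
qed

lemma recursive_Pair [recursive_intros]:
  assumes "recursive f" "recursive g"
  shows "recursive (\<lambda>x. (f x, g x))"
proof -
  obtain e e' where e: "\<And>x. rec_eval e [enc x] (enc (f x))" "\<And>x. rec_eval e' [enc x] (enc (g x))"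
    using assms unfolding recursive_def by blast
  obtain d where d: "\<And>xs. length xs = 2 \<Longrightarrow> rec_eval d xs (prod_encode (xs ! 0, xs ! 1))"
    using recursive_list_prod_encode unfolding recursive_list_def by blast
  have "rec_eval (Comp d [e, e']) [enc x] (enc (f x, g x))" for x
    by (rule rec_eval.Comp[where ys = "[enc (f x), enc (g x)]"])
      (use d[of "[enc (f x), enc (g x)]"] in \<open>auto intro: e simp: less_Suc_eq enc_prod_def\<close>)
  then show ?thesis unfolding recursive_def by blast
qed

lemma recursive_comp2:
  assumes "recursive (\<lambda>z. f (fst z) (snd z))" "recursive g" "recursive h"
  shows "recursive (\<lambda>x. f (g x) (h x))"
  using recursive_comp[OF assms(1) recursive_Pair[OF assms(2,3)]] by simp

lemma recursive_fst [recursive_intros]: "recursive f \<Longrightarrow> recursive (\<lambda>x. fst (f x))"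
  by (rule recursive_comp[of fst], rule recursiveI[OF recursive_list_fst_prod_decode])
    (simp_all add: enc_prod_def)

lemma recursive_snd [recursive_intros]: "recursive f \<Longrightarrow> recursive (\<lambda>x. snd (f x))"
  by (rule recursive_comp[of snd], rule recursiveI[OF recursive_list_snd_prod_decode])
    (simp_all add: enc_prod_def)

lemma recursive_Suc [recursive_intros]: "recursive f \<Longrightarrow> recursive (\<lambda>x. Suc (f x))"
  by (rule recursive_comp[of Suc], rule recursiveI[where g = Suc])
    (auto intro!: recursive_list_Suc recursive_list_nth)

lemma recursive_same_code:
  assumes "recursive f" "\<And>x. enc (g x) = enc x"
  shows "recursive (\<lambda>x. g (f x))"
  using assms unfolding recursive_def by simp

lemma recursive_enc [recursive_intros]: "recursive f \<Longrightarrow> recursive (\<lambda>x. enc (f x))"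
  by (rule recursive_same_code) simp_all

lemma recursive_list_encode [recursive_intros]: "recursive f \<Longrightarrow> recursive (\<lambda>x. list_encode (f x))"
  by (rule recursive_same_code) (simp_all add: enc_nat_list)

lemma recursive_list_decode [recursive_intros]: "recursive f \<Longrightarrow> recursive (\<lambda>x. list_decode (f x))"
  by (rule recursive_same_code) (simp_all add: enc_nat_list)

lemma recursive_prod_encode [recursive_intros]:
  fixes f :: "'a :: coded \<Rightarrow> nat \<times> nat"
  shows "recursive f \<Longrightarrow> recursive (\<lambda>x. prod_encode (f x))"
  by (rule recursive_same_code) (simp_all add: enc_prod_def)

lemma recursive_prod_decode [recursive_intros]: "recursive f \<Longrightarrow> recursive (\<lambda>x. prod_decode (f x))"
  by (rule recursive_same_code) (simp_all add: enc_prod_def)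

text \<open>\<open>PrimRec\<close> hands counter, previous value and parameter to its step as three
  arguments, whereas \<open>g\<close> is recursive in one nested pair; \<open>?G\<close> repacks
  them.\<close>

lemma recursive_rec_nat [recursive_intros]:
  assumes "recursive f" "recursive N"
    and "recursive (\<lambda>z. g (fst z) (fst (snd z)) (snd (snd z)))"
  shows "recursive (\<lambda>x. rec_nat (f x) (\<lambda>k y. g k y x) (N x))"
proof -
  obtain e where e: "\<And>x. rec_eval e [enc x] (enc (f x))"
    using assms unfolding recursive_def by blast
  obtain eN where eN: "\<And>x. rec_eval eN [enc x] (N x)"
    using assms unfolding recursive_def by auto
  obtain eg where eg: "\<And>k y x. rec_eval eg [enc (k, y, x)] (enc (g k y x))"
    using assms unfolding recursive_def by fastforce
  obtain d where d: "\<And>xs. length xs = 2 \<Longrightarrow> rec_eval d xs (prod_encode (xs ! 0, xs ! 1))"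
    using recursive_list_prod_encode unfolding recursive_list_def by blast
  let ?G = "Comp eg [Comp d [Proj 0, Comp d [Proj (Suc 0), Proj 2]]]"
  have proj: "rec_eval (Proj 0) [a, b, c] a" "rec_eval (Proj (Suc 0)) [a, b, c] b"
    "rec_eval (Proj 2) [a, b, c] c" for a b c
    using rec_eval.Proj[of 0 "[a, b, c]"] rec_eval.Proj[of 1 "[a, b, c]"]
      rec_eval.Proj[of 2 "[a, b, c]"] by auto
  have "rec_eval (Comp d [Proj (Suc 0), Proj 2]) [k, enc y, enc x] (enc (y, x))" for k and y :: 'b and x :: 'a
    by (rule rec_eval.Comp[where ys = "[enc y, enc x]"])
      (use d[of "[enc y, enc x]"] in \<open>auto intro: proj simp: less_Suc_eq enc_prod_def\<close>)
  then have "rec_eval (Comp d [Proj 0, Comp d [Proj (Suc 0), Proj 2]]) [k, enc y, enc x] (enc (k, y, x))"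
    for k and y :: 'b and x :: 'a
    by (intro rec_eval.Comp[where ys = "[k, enc (y, x)]"])
      (use d[of "[k, enc (y, x)]"] in \<open>auto intro: proj simp: less_Suc_eq enc_prod_def\<close>)
  then have G: "rec_eval ?G [k, enc y, enc x] (enc (g k y x))" for k y x
    by (intro rec_eval.Comp[where ys = "[enc (k, y, x)]"]) (auto intro: eg)
  have P: "rec_eval (PrimRec e ?G) [m, enc x] (enc (rec_nat (f x) (\<lambda>k y. g k y x) m))" for m x
    by (induction m) (auto intro!: rec_eval.PrimRec_0 rec_eval.PrimRec_Suc e G)
  have "rec_eval (Comp (PrimRec e ?G) [eN, Proj 0]) [enc x] (enc (rec_nat (f x) (\<lambda>k y. g k y x) (N x)))"
    for x
    by (rule rec_eval.Comp[where ys = "[N x, enc x]"])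
      (use rec_eval.Proj[of 0 "[enc x]"] in \<open>auto intro: P eN simp: less_Suc_eq\<close>)
  then show ?thesis unfolding recursive_def by blast
qed

lemma recursive_binary_nat:
  fixes g :: "nat \<Rightarrow> nat \<Rightarrow> nat"
  assumes "recursive_list 2 (\<lambda>xs. g (xs ! 0) (xs ! 1))" "recursive f" "recursive f'"
  shows "recursive (\<lambda>x. g (f x) (f' x))"
proof (rule recursive_comp2[OF _ assms(2,3)])
  show "recursive (\<lambda>z. g (fst z) (snd z))"
    by (rule recursiveI[OF recursive_list_comp2[OF assms(1)
            recursive_list_fst_prod_decode recursive_list_snd_prod_decode]])
      (simp add: enc_prod_def)
qed

lemma recursive_diff [recursive_intros]:
  fixes f g :: "'a :: coded \<Rightarrow> nat"
  shows "recursive f \<Longrightarrow> recursive g \<Longrightarrow> recursive (\<lambda>x. f x - g x)"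
  by (rule recursive_binary_nat[OF recursive_list_diff])

lemma recursive_add [recursive_intros]:
  fixes f g :: "'a :: coded \<Rightarrow> nat"
  shows "recursive f \<Longrightarrow> recursive g \<Longrightarrow> recursive (\<lambda>x. f x + g x)"
  by (rule recursive_binary_nat[OF recursive_list_add])

lemma recursive_eq [recursive_intros]:
  assumes "recursive f" "recursive g"
  shows "recursive (\<lambda>x. f x = g x)"
proof -
  have "recursive (\<lambda>x. rec_nat True (\<lambda>_ _. False) ((enc (f x) - enc (g x)) + (enc (g x) - enc (f x))))"
    by (intro recursive_intros assms)
  moreover have "rec_nat True (\<lambda>_ _. False) m \<longleftrightarrow> m = 0" for m by (cases m) auto
  moreover have "(enc a - enc b) + (enc b - enc a) = 0 \<longleftrightarrow> a = b" for a b :: 'b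
    using enc_inject[of a b] by linarith
  ultimately show ?thesis by simp
qed

lemma recursive_if [recursive_intros]:
  assumes "recursive P" "recursive f" "recursive g"
  shows "recursive (\<lambda>x. if P x then f x else g x)"
proof -
  have "recursive (\<lambda>x. rec_nat (g x) (\<lambda>_ _. f x) (enc (P x)))"
    by (intro recursive_intros assms recursive_comp[OF assms(2)])
  moreover have "rec_nat (g x) (\<lambda>_ _. f x) (enc (P x)) = (if P x then f x else g x)" for x
    by auto
  ultimately show ?thesis by simp
qed

section \<open>Recursive operations on words\<close>

lemma recursive_Cons [recursive_intros]:
  assumes "recursive f" "recursive g"
  shows "recursive (\<lambda>x. f x # g x)"
proof -
  have "recursive (\<lambda>x. Suc (enc (f x, g x)))" by (intro recursive_intros assms)
  then show ?thesis by (simp add: recursive_def enc_prod_def enc_list_def)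
qed

lemma recursive_tl [recursive_intros]:
  fixes f :: "'a :: coded \<Rightarrow> nat list"
  assumes "recursive f"
  shows "recursive (\<lambda>x. tl (f x))"
proof -
  have "recursive (\<lambda>x. list_decode (snd (prod_decode (enc (f x) - 1))))"
    by (intro recursive_intros assms)
  moreover have "list_decode (snd (prod_decode (enc xs - 1))) = tl xs" for xs :: "nat list"
  proof (cases xs)
    \<comment> \<open>The code 0 stays 0 under truncated subtraction, and its second component 0
      decodes to the empty word, which is \<open>tl []\<close>.\<close>
    case Nil
    have "prod_decode 0 = (0, 0)" by (simp add: prod_decode_def prod_decode_aux.simps)
    then show ?thesis by (simp add: Nil enc_nat_list)
  qed (simp add: enc_nat_list)
  ultimately show ?thesis by simp
qed

definition hd0 :: "nat list \<Rightarrow> nat" where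
  "hd0 xs = (if xs = [] then 0 else hd xs)"

lemma recursive_hd0 [recursive_intros]:
  assumes "recursive f"
  shows "recursive (\<lambda>x. hd0 (f x))"
proof -
  have "recursive (\<lambda>x. if f x = [] then 0 else fst (prod_decode (enc (f x) - 1)))"
    by (intro recursive_intros assms)
  moreover have "(if xs = [] then 0 else fst (prod_decode (enc xs - 1))) = hd0 xs" for xs
    by (cases xs) (simp_all add: enc_nat_list hd0_def)
  ultimately show ?thesis by simp
qed

text \<open>The code bounds the number of letters, and it is available as a bound before
  \<open>length\<close> is known to be recursive.\<close>

lemma length_le_list_encode: "length xs \<le> list_encode xs"
proof (induction xs)
  case (Cons x xs)
  then show ?case using le_prod_encode_2[of "list_encode xs" x] by simp
qed simp

lemma recursive_foldl [recursive_intros]: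
  fixes l :: "'a :: coded \<Rightarrow> nat list"
  assumes a: "recursive a" and l: "recursive l"
    and g: "recursive (\<lambda>z. g (fst z) (fst (snd z)) (snd (snd z)))"
  shows "recursive (\<lambda>x. foldl (\<lambda>v i. g v i x) (a x) (l x))"
proof -
  \<comment> \<open>The state holds the accumulator and the letters still to be read. It is
    stationary once no letter is left, so iterating too often is harmless.\<close>
  let ?step = "\<lambda>s x. if snd s = [] then s else (g (fst s) (hd0 (snd s)) x, tl (snd s))"
  have g': "recursive (\<lambda>x. g (A x) (B x) (C x))"
    if "recursive A" "recursive B" "recursive C" for A :: "'c :: coded \<Rightarrow> _" and B C
    using recursive_comp[OF g recursive_Pair[OF that(1) recursive_Pair[OF that(2,3)]]] by simp
  have "recursive (\<lambda>x. fst (rec_nat (a x, l x) (\<lambda>_ s. ?step s x) (enc (l x))))"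
    by (intro recursive_intros assms g')
  moreover have "fst (rec_nat (a x, l x) (\<lambda>_ s. ?step s x) (enc (l x))) =
      foldl (\<lambda>v i. g v i x) (a x) (l x)" for x
  proof -
    have "rec_nat (v, xs) (\<lambda>_ s. ?step s x) n =
        (foldl (\<lambda>v i. g v i x) v (take n xs), drop n xs)" for v xs n
    proof (induction n)
      case (Suc n)
      show ?case
        by (cases "n < length xs")
          (auto simp: Suc take_Suc_conv_app_nth hd0_def hd_drop_conv_nth drop_Suc tl_drop)
    qed simp
    then show ?thesis
      using length_le_list_encode[of "l x"] by (simp add: enc_nat_list)
  qed
  ultimately show ?thesis by simp
qed

lemma recursive_rev [recursive_intros]:
  fixes f :: "'a :: coded \<Rightarrow> nat list"
  assumes "recursive f"
  shows "recursive (\<lambda>x. rev (f x))"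
proof -
  have "recursive (\<lambda>x. foldl (\<lambda>v i. i # v) [] (f x))"
    by (intro recursive_intros assms)
  then show ?thesis by (simp add: foldl_conv_fold rev_conv_fold)
qed

lemma recursive_append [recursive_intros]:
  fixes f g :: "'a :: coded \<Rightarrow> nat list"
  assumes "recursive f" "recursive g"
  shows "recursive (\<lambda>x. f x @ g x)"
proof -
  have "recursive (\<lambda>x. foldl (\<lambda>v i. i # v) (g x) (rev (f x)))"
    by (intro recursive_intros assms)
  moreover have "foldl (\<lambda>v i. i # v) ys (rev xs) = xs @ ys" for xs ys :: "nat list"
    by (induction xs) auto
  ultimately show ?thesis by simp
qed

lemma recursive_length [recursive_intros]:
  fixes f :: "'a :: coded \<Rightarrow> nat list"
  assumes "recursive f"
  shows "recursive (\<lambda>x. length (f x))"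
proof -
  have "recursive (\<lambda>x. foldl (\<lambda>v i. Suc v) 0 (f x))"
    by (intro recursive_intros assms)
  moreover have "foldl (\<lambda>v i. Suc v) n xs = n + length xs" for n and xs :: "nat list"
    by (induction xs arbitrary: n) auto
  ultimately show ?thesis by simp
qed

lemma recursive_drop [recursive_intros]:
  fixes f :: "'a :: coded \<Rightarrow> nat list"
  assumes "recursive N" "recursive f"
  shows "recursive (\<lambda>x. drop (N x) (f x))"
proof -
  have "recursive (\<lambda>x. rec_nat (f x) (\<lambda>_ v. tl v) (N x))"
    by (intro recursive_intros assms)
  moreover have "rec_nat xs (\<lambda>_ v. tl v) n = drop n xs" for n and xs :: "nat list"
    by (induction n) (auto simp: drop_Suc tl_drop)
  ultimately show ?thesis by simp
qed

lemma recursive_map_upt [recursive_intros]: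
  assumes N: "recursive N" and g: "recursive (\<lambda>z. g (fst z) (snd z))"
  shows "recursive (\<lambda>x. map (\<lambda>i. g i x :: nat) [0..<N x])"
proof -
  have "recursive (\<lambda>x. rec_nat [] (\<lambda>k v. v @ [g k x]) (N x))"
    by (intro recursive_intros N recursive_comp2[OF g])
  moreover have "rec_nat [] (\<lambda>k v. v @ [g k x]) n = map (\<lambda>i. g i x) [0..<n]" for x n
    by (induction n) auto
  ultimately show ?thesis by simp
qed

text \<open>Beyond the end of the word the value is 0, so \<open>nth0 w\<close> is a point of Baire
  space with \<open>w\<close> as initial segment.\<close>

definition nth0 :: "nat list \<Rightarrow> nat \<Rightarrow> nat" where
  "nth0 xs i = hd0 (drop i xs)"

lemma nth0_eq_nth [simp]: "i < length xs \<Longrightarrow> nth0 xs i = xs ! i"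
  by (simp add: nth0_def hd0_def hd_drop_conv_nth)

lemma recursive_nth0 [recursive_intros]:
  "recursive f \<Longrightarrow> recursive N \<Longrightarrow> recursive (\<lambda>x. nth0 (f x) (N x))"
  unfolding nth0_def by (intro recursive_intros)

lemma recursive_take [recursive_intros]:
  fixes f :: "'a :: coded \<Rightarrow> nat list"
  assumes "recursive N" "recursive f"
  shows "recursive (\<lambda>x. take (N x) (f x))"
proof -
  have "recursive (\<lambda>x. rev (drop (length (f x) - N x) (rev (f x))))"
    by (intro recursive_intros assms)
  moreover have "rev (drop (length xs - n) (rev xs)) = take n xs" for n and xs :: "nat list"
    by (cases "n \<le> length xs") (simp_all add: rev_drop)
  ultimately show ?thesis by simp
qed

lemma recursive_prefix [recursive_intros]:
  fixes f g :: "'a :: coded \<Rightarrow> nat list"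
  assumes "recursive f" "recursive g"
  shows "recursive (\<lambda>x. prefix (f x) (g x))"
proof -
  have "recursive (\<lambda>x. take (length (f x)) (g x) = f x)"
    by (intro recursive_intros assms)
  moreover have "take (length v) w = v \<longleftrightarrow> prefix v w" for v w :: "nat list"
    by (metis append_eq_conv_conj prefix_def take_is_prefix)
  ultimately show ?thesis by simp
qed

lemma recursive_div2 [recursive_intros]:
  assumes "recursive f"
  shows "recursive (\<lambda>x. f x div 2 :: nat)"
proof -
  \<comment> \<open>After \<open>n\<close> steps the pair holds \<open>n div 2\<close> and
    \<open>Suc n div 2\<close>; one more step moves the second to the front and appends the
    successor of the first.\<close>
  have "recursive (\<lambda>x. fst (rec_nat (0, 0) (\<lambda>_ s. (snd s, Suc (fst s))) (f x)))"
    by (intro recursive_intros assms)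
  moreover have "rec_nat (0, 0) (\<lambda>_ s. (snd s, Suc (fst s))) n = (n div 2, Suc n div 2)" for n
    by (induction n) auto
  ultimately show ?thesis by simp
qed

section \<open>Word functions and the functions they induce\<close>

definition pre :: "baire \<Rightarrow> nat \<Rightarrow> nat list" where
  "pre p n = map p [0..<n]"

lemma length_pre [simp]: "length (pre p n) = n"
  by (simp add: pre_def)

lemma nth_pre [simp]: "i < n \<Longrightarrow> pre p n ! i = p i"
  by (simp add: pre_def)

lemma pre_0 [simp]: "pre p 0 = []"
  by (simp add: pre_def)

lemma pre_Suc: "pre p (Suc n) = pre p n @ [p n]"
  by (simp add: pre_def)

lemma pre_eq_iff: "pre p n = pre q n \<longleftrightarrow> (\<forall>i<n. p i = q i)"
  by (auto simp: pre_def)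

lemma take_pre [simp]: "take m (pre p n) = pre p (min m n)"
  by (auto simp: pre_def take_map min_def)

lemma pre_nth0: "n \<le> length w \<Longrightarrow> pre (nth0 w) n = take n w"
  by (auto intro: nth_equalityI)

lemma initial_iff_pre: "w \<sqsubset>\<^sub>B p \<longleftrightarrow> w = pre p (length w)"
  by (simp add: initial_def pre_def)

lemma initialE:
  assumes "w \<sqsubset>\<^sub>B p"
  obtains n where "w = pre p n"
  using assms unfolding initial_iff_pre by (rule that)

lemma initial_pre [simp]: "pre p n \<sqsubset>\<^sub>B p"
  by (simp add: initial_iff_pre)

lemma prefix_pre: "m \<le> n \<Longrightarrow> prefix (pre p m) (pre p n)"
  by (metis min_absorb1 take_pre take_is_prefix)

lemma initial_prefix_trans: "prefix v w \<Longrightarrow> w \<sqsubset>\<^sub>B p \<Longrightarrow> v \<sqsubset>\<^sub>B p"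
  by (metis append_eq_conv_conj initial_iff_pre initial_pre prefix_def take_pre)

lemma initial_nth: "w \<sqsubset>\<^sub>B p \<Longrightarrow> i < length w \<Longrightarrow> p i = w ! i"
  by (metis initial_iff_pre nth_pre)

lemma monotone_word_funD: "monotone_word_fun h \<Longrightarrow> prefix v w \<Longrightarrow> prefix (h v) (h w)"
  by (simp add: monotone_word_fun_def monotone_def)

text \<open>Every word is an initial segment of its continuation by zeros, so monotonicity may be
  checked along infinite sequences.\<close>

lemma monotone_word_funI:
  assumes "\<And>p m n. m \<le> n \<Longrightarrow> prefix (h (pre p m)) (h (pre p n))"
  shows "monotone_word_fun h"
  unfolding monotone_word_fun_def monotone_def
proof (intro allI impI)
  fix v w :: "nat list"
  assume "prefix v w"
  then have len: "length v \<le> length w" and "take (length v) w = v"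
    by (auto simp: prefix_def)
  then have "pre (nth0 w) (length v) = v" "pre (nth0 w) (length w) = w"
    by (simp_all add: pre_nth0)
  then show "prefix (h v) (h w)" using assms[OF len, of "nth0 w"] by simp
qed

definition approximates :: "(nat \<Rightarrow> nat list) \<Rightarrow> baire \<Rightarrow> bool" where
  "approximates s p \<longleftrightarrow> (\<forall>m n. m \<le> n \<longrightarrow> prefix (s m) (s n)) \<and> (\<forall>n. s n \<sqsubset>\<^sub>B p) \<and>
    (\<forall>m. \<exists>n. m \<le> length (s n))"

lemma approximatesD:
  assumes "approximates s p"
  shows "m \<le> n \<Longrightarrow> prefix (s m) (s n)" "s n \<sqsubset>\<^sub>B p" "s n = pre p (length (s n))"
    "\<exists>n. m \<le> length (s n)"
  using assms unfolding approximates_def initial_iff_pre by blast+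

lemma approximates_pre: "approximates (\<lambda>n. pre p n) p"
  by (auto simp: approximates_def prefix_pre)

lemma approximates_reindex:
  assumes "approximates s p" "\<And>m n. m \<le> n \<Longrightarrow> l m \<le> l n" "\<And>m. \<exists>n. m \<le> (l n :: nat)"
  shows "approximates (\<lambda>n. s (l n)) p"
  unfolding approximates_def
proof (intro conjI allI)
  fix m
  obtain n where "m \<le> length (s n)" using approximatesD[OF assms(1)] by blast
  moreover obtain k where "n \<le> l k" using assms(3) by blast
  ultimately show "\<exists>n. m \<le> length (s (l n))"
    using prefix_length_le[OF approximatesD(1)[OF assms(1), of n "l k"]] le_trans by blast
qed (use approximatesD[OF assms(1)] assms(2) in auto)

lemma approximates_unique:
  assumes "approximates s p" "\<And>n. s n \<sqsubset>\<^sub>B q"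
  shows "p = q"
proof
  fix i
  obtain n where "Suc i \<le> length (s n)" using approximatesD(4)[OF assms(1)] by blast
  then show "p i = q i"
    using initial_nth[of "s n" p i] initial_nth[of "s n" q i]
      approximatesD(2)[OF assms(1), of n] assms(2)[of n] by simp
qed

text \<open>All words of a chain that reach position \<open>i\<close> agree there, so the limit can
  be read off from any one of them, here \<open>s (N i)\<close>.\<close>

lemma approximates_exists:
  assumes mono: "\<And>m n. m \<le> n \<Longrightarrow> prefix (s m) (s n)" and unb: "\<And>m. \<exists>n. m \<le> length (s n)"
  shows "\<exists>p. approximates s p"
proof -
  have "\<forall>i. \<exists>n. Suc i \<le> length (s n)" using unb by blast
  then obtain N where N: "\<And>i. Suc i \<le> length (s (N i))" by metis
  have "s n ! i = s (N i) ! i" if "i < length (s n)" for n i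
  proof (cases "n \<le> N i")
    case True
    then show ?thesis using mono[OF True] that by (auto simp: prefix_def nth_append)
  next
    case False
    then show ?thesis using mono[of "N i" n] N[of i] by (auto simp: prefix_def nth_append)
  qed
  then have "s n \<sqsubset>\<^sub>B (\<lambda>i. s (N i) ! i)" for n
    unfolding initial_def by (auto intro: nth_equalityI)
  then show ?thesis using mono unb unfolding approximates_def by blast
qed

text \<open>Replaces the definite description by convergence: the initial segments of
  \<open>p\<close> are the \<open>pre p n\<close>, and a chain of unbounded length has exactly one
  limit.\<close>

lemma word_fun_sup_eq_Some_iff:
  assumes "monotone_word_fun h"
  shows "word_fun_sup h p = Some r \<longleftrightarrow> approximates (\<lambda>n. h (pre p n)) r"
proof -
  let ?s = "\<lambda>n. h (pre p n)"
  have mono: "prefix (?s m) (?s n)" if "m \<le> n" for m n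
    using that assms by (auto intro: monotone_word_funD prefix_pre)
  have ex: "(\<forall>n. \<exists>w. w \<sqsubset>\<^sub>B p \<and> n \<le> length (h w)) \<longleftrightarrow> (\<forall>n. \<exists>m. n \<le> length (?s m))"
    by (metis initialE initial_pre)
  have the: "(THE r. \<forall>w. w \<sqsubset>\<^sub>B p \<longrightarrow> h w \<sqsubset>\<^sub>B r) = r" if r: "approximates ?s r" for r
  proof (rule the_equality)
    show "\<forall>w. w \<sqsubset>\<^sub>B p \<longrightarrow> h w \<sqsubset>\<^sub>B r"
      using approximatesD(2)[OF r] by (auto elim: initialE)
    show "r' = r" if "\<forall>w. w \<sqsubset>\<^sub>B p \<longrightarrow> h w \<sqsubset>\<^sub>B r'" for r'
      using approximates_unique[OF r, of r'] that by auto
  qed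
  show ?thesis
  proof (cases "\<forall>n. \<exists>m. n \<le> length (?s m)")
    case True
    then obtain r' where r': "approximates ?s r'" using approximates_exists[of ?s] mono by blast
    have "word_fun_sup h p = Some r'"
      using True the[OF r'] unfolding word_fun_sup_def ex by simp
    then show ?thesis using r' approximates_unique[OF r'] approximatesD(2) by fastforce
  next
    case False
    then show ?thesis unfolding word_fun_sup_def ex approximates_def by auto
  qed
qed

text \<open>The supremum is the same along every chain converging to \<open>p\<close>: each
  \<open>s n\<close> is a segment of \<open>p\<close>, and each segment of \<open>p\<close> is a
  prefix of some \<open>s k\<close>.\<close>

lemma approximates_word_fun:
  assumes "monotone_word_fun h" "word_fun_sup h p = Some r" "approximates s p"
  shows "approximates (\<lambda>n. h (s n)) r"
  unfolding approximates_def
proof (intro conjI allI impI)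
  have r: "approximates (\<lambda>n. h (pre p n)) r"
    using assms word_fun_sup_eq_Some_iff by blast
  show "prefix (h (s m)) (h (s n))" if "m \<le> n" for m n
    using that assms approximatesD(1) monotone_word_funD by blast
  show "h (s n) \<sqsubset>\<^sub>B r" for n
    using approximatesD(2)[OF r] approximatesD(3)[OF assms(3)] by metis
  fix m
  obtain n where n: "m \<le> length (h (pre p n))" using approximatesD(4)[OF r] by blast
  obtain k where "n \<le> length (s k)" using approximatesD(4)[OF assms(3)] by blast
  then have "prefix (pre p n) (s k)"
    using approximatesD(3)[OF assms(3)] prefix_pre by metis
  then have "length (h (pre p n)) \<le> length (h (s k))"
    using assms(1) monotone_word_funD prefix_length_le by blast
  then show "\<exists>n. m \<le> length (h (s n))" using n le_trans by blast
qed

lemma monotone_word_fun_comp: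
  "monotone_word_fun h \<Longrightarrow> monotone_word_fun g \<Longrightarrow> monotone_word_fun (\<lambda>w. h (g w))"
  by (simp add: monotone_word_fun_def monotone_def)

lemma word_fun_sup_comp:
  assumes "monotone_word_fun h" "monotone_word_fun g"
    and "word_fun_sup g p = Some q" "word_fun_sup h q = Some r"
  shows "word_fun_sup (\<lambda>w. h (g w)) p = Some r"
  using assms approximates_word_fun[OF assms(1,4)]
  by (simp add: word_fun_sup_eq_Some_iff monotone_word_fun_comp)

subsection \<open>Interleaving\<close>

text \<open>Word version of \<open>bpair\<close>, cut according to the shorter word so that no gaps
  arise. Evenness is expressed by \<open>div 2\<close> and addition, which have closure
  rules.\<close>

definition interleave :: "nat list \<Rightarrow> nat list \<Rightarrow> nat list" where
  "interleave v w = map (\<lambda>i. if i div 2 + i div 2 = i then nth0 v (i div 2) else nth0 w (i div 2))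
     [0..<min (length v) (length w) + min (length v) (length w)]"

lemma interleave_pre: "interleave (pre p m) (pre q n) = pre (bpair p q) (2 * min m n)"
proof -
  have "i div 2 + i div 2 = i \<longleftrightarrow> even i" for i :: nat by presburger
  then show ?thesis
    unfolding interleave_def pre_def[of "bpair p q"] bpair_def
    by (intro map_cong arg_cong[where f = "upt 0"]) auto
qed

lemma recursive_interleave [recursive_intros]:
  assumes "recursive f" "recursive g"
  shows "recursive (\<lambda>x. interleave (f x) (g x))"
proof -
  have "min a b = a - (a - b)" for a b :: nat by simp
  then show ?thesis
    unfolding interleave_def
    by (simp only:) (intro recursive_intros assms recursive_comp[OF assms(1)] recursive_comp[OF assms(2)])
qed

lemma approximates_interleave:
  assumes s: "approximates s p" and t: "approximates t q"
  shows "approximates (\<lambda>n. interleave (s n) (t n)) (bpair p q)"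
proof -
  let ?l = "\<lambda>n. 2 * min (length (s n)) (length (t n))"
  have eq: "interleave (s n) (t n) = pre (bpair p q) (?l n)" for n
    using interleave_pre[of p "length (s n)" q "length (t n)"]
    by (simp flip: approximatesD(3)[OF s] approximatesD(3)[OF t])
  have mono: "?l m \<le> ?l n" if "m \<le> n" for m n
    using prefix_length_le[OF approximatesD(1)[OF s that]]
      prefix_length_le[OF approximatesD(1)[OF t that]] by auto
  have "\<exists>n. m \<le> ?l n" for m
  proof -
    obtain i j where "m \<le> length (s i)" "m \<le> length (t j)"
      using approximatesD(4)[OF s] approximatesD(4)[OF t] by blast
    moreover have "length (s i) \<le> length (s (max i j))" "length (t j) \<le> length (t (max i j))"
      by (auto intro!: prefix_length_le approximatesD(1)[OF s] approximatesD(1)[OF t])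
    ultimately show ?thesis by (intro exI[of _ "max i j"]) auto
  qed
  then show ?thesis
    unfolding eq by (intro approximates_reindex[OF approximates_pre] mono)
qed

text \<open>The last letter of a word of odd length is dropped, so that \<open>evens\<close> and
  \<open>odds\<close> are equally long.\<close>

definition evens :: "nat list \<Rightarrow> nat list" where
  "evens w = map (\<lambda>i. nth0 w (i + i)) [0..<length w div 2]"

definition odds :: "nat list \<Rightarrow> nat list" where
  "odds w = map (\<lambda>i. nth0 w (Suc (i + i))) [0..<length w div 2]"

lemma evens_pre: "evens (pre p n) = pre (bfst p) (n div 2)"
  unfolding evens_def by (auto simp: pre_def[of "bfst p"] bfst_def mult_2)

lemma odds_pre: "odds (pre p n) = pre (bsnd p) (n div 2)"
  unfolding odds_def by (auto simp: pre_def[of "bsnd p"] bsnd_def mult_2)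

lemma recursive_evens [recursive_intros]:
  assumes "recursive f"
  shows "recursive (\<lambda>x. evens (f x))"
  unfolding evens_def by (intro recursive_intros assms recursive_comp[OF assms])

lemma recursive_odds [recursive_intros]:
  assumes "recursive f"
  shows "recursive (\<lambda>x. odds (f x))"
  unfolding odds_def by (intro recursive_intros assms recursive_comp[OF assms])

lemma monotone_word_fun_odds: "monotone_word_fun odds"
  by (rule monotone_word_funI) (auto simp: odds_pre intro: prefix_pre div_le_mono)

lemma word_fun_sup_odds: "word_fun_sup odds p = Some (bsnd p)"
proof -
  have "\<exists>n. m \<le> n div 2" for m :: nat by (rule exI[of _ "2 * m"]) simp
  then show ?thesis
    unfolding word_fun_sup_eq_Some_iff[OF monotone_word_fun_odds] odds_pre
    by (intro approximates_reindex[OF approximates_pre]) (auto intro: div_le_mono)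
qed

subsection \<open>Monotonisation\<close>

definition extend :: "nat list \<Rightarrow> nat list \<Rightarrow> nat list" where
  "extend v w = (if prefix v w then w else v)"

lemma prefix_extend: "prefix v (extend v w)"
  by (simp add: extend_def)

lemma recursive_extend [recursive_intros]:
  "recursive f \<Longrightarrow> recursive g \<Longrightarrow> recursive (\<lambda>x. extend (f x) (g x))"
  unfolding extend_def by (intro recursive_intros)

text \<open>The values of \<open>c\<close> on the prefixes of \<open>w\<close>, shortest first, are
  candidates for the output, and \<open>extend\<close> rejects those that do not continue it. The
  bound \<open>Suc (length w)\<close> makes \<open>w\<close> itself the last prefix.\<close>

definition monotonise :: "(nat list \<Rightarrow> nat list) \<Rightarrow> nat list \<Rightarrow> nat list" where
  "monotonise c w = rec_nat [] (\<lambda>t v. extend v (c (take t w))) (Suc (length w))"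

lemma recursive_monotonise [recursive_intros]:
  assumes "recursive g" "recursive (\<lambda>z. c (fst z) (snd z))"
  shows "recursive (\<lambda>x. monotonise (c x) (g x))"
  unfolding monotonise_def
  by (intro recursive_intros assms recursive_comp2[OF assms(2)] recursive_comp[OF assms(1)])

lemma monotonise_pre: "monotonise c (pre p n) = rec_nat [] (\<lambda>t v. extend v (c (pre p t))) (Suc n)"
proof -
  have "rec_nat [] (\<lambda>t v. extend v (c (take t (pre p n)))) m =
      rec_nat [] (\<lambda>t v. extend v (c (pre p t))) m" if "m \<le> Suc n" for m
    using that by (induction m) (auto simp: min_def)
  then show ?thesis by (simp add: monotonise_def)
qed

lemma monotone_monotonise: "monotone_word_fun (monotonise c)"
proof (rule monotone_word_funI)
  fix p and m n :: nat
  assume "m \<le> n"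
  then show "prefix (monotonise c (pre p m)) (monotonise c (pre p n))"
  proof (induction rule: dec_induct)
    case (step n)
    have "prefix (monotonise c (pre p n)) (monotonise c (pre p (Suc n)))"
      unfolding monotonise_pre by (simp add: prefix_extend)
    with step show ?case using prefix_order.trans by blast
  qed simp
qed

text \<open>Where \<open>c\<close> is a chain along the single sequence \<open>p\<close>, no
  candidate is rejected; thus convergent computations survive even if \<open>c\<close> misbehaves
  elsewhere.\<close>

lemma monotonise_eq:
  assumes "\<And>m n. m \<le> n \<Longrightarrow> prefix (c (pre p m)) (c (pre p n))"
  shows "monotonise c (pre p n) = c (pre p n)"
proof (induction n)
  case 0
  show ?case using monotonise_pre[of c p 0] by (simp add: extend_def)
next
  case (Suc n)
  then show ?case
    using assms[of n "Suc n"] by (simp add: monotonise_pre extend_def)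
qed

lemma monotonise_cong:
  assumes "\<And>v. prefix v w \<Longrightarrow> c v = c' v"
  shows "monotonise c w = monotonise c' w"
  unfolding monotonise_def using assms by (simp add: take_is_prefix)

subsection \<open>Applying a listed word function\<close>

text \<open>The value at \<open>u\<close> as far as it is known from the finite part \<open>w\<close> of a listing of a graph.\<close>

definition apply_listed :: "nat list \<Rightarrow> nat list \<Rightarrow> nat list" where
  "apply_listed w u = foldl (\<lambda>v i. if prefix (list_decode (fst (prod_decode i))) u
     then extend v (list_decode (snd (prod_decode i))) else v) [] w"

lemma recursive_apply_listed [recursive_intros]:
  assumes "recursive f" "recursive g"
  shows "recursive (\<lambda>x. apply_listed (f x) (g x))"
  unfolding apply_listed_def by (intro recursive_intros assms recursive_comp[OF assms(2)])

lemma apply_listed_cases: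
  assumes "lists_graph q g"
  shows "apply_listed (pre q n) u = [] \<or>
    (\<exists>i<n. \<exists>w. q i = prod_encode (list_encode w, list_encode (g w)) \<and> prefix w u \<and>
      apply_listed (pre q n) u = g w)"
proof (induction n)
  case (Suc n)
  obtain w where "q n = prod_encode (list_encode w, list_encode (g w))"
    using assms unfolding lists_graph_def by blast
  with Suc show ?case
    by (auto simp: apply_listed_def pre_Suc extend_def less_Suc_eq)
qed (simp add: apply_listed_def)

text \<open>By monotonicity all values at prefixes of \<open>u\<close> are prefixes of
  \<open>g u\<close>, hence comparable; \<open>extend\<close> then keeps the longer of two and loses
  nothing listed so far.\<close>

lemma prefix_apply_listed:
  assumes g: "monotone_word_fun g" and q: "lists_graph q g"
    and "i < n" "q i = prod_encode (list_encode w, list_encode (g w))" "prefix w u"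
  shows "prefix (g w) (apply_listed (pre q n) u)"
  using assms(3)
proof (induction n)
  case (Suc n)
  obtain w' where w': "q n = prod_encode (list_encode w', list_encode (g w'))"
    using q unfolding lists_graph_def by blast
  have step: "apply_listed (pre q (Suc n)) u =
      (if prefix w' u then extend (apply_listed (pre q n) u) (g w') else apply_listed (pre q n) u)"
    by (simp add: apply_listed_def pre_Suc w')
  show ?case
  proof (cases "i < n")
    case True
    with Suc show ?thesis
      using prefix_order.trans[OF _ prefix_extend] by (auto simp: step)
  next
    case False
    with Suc have "i = n" by simp
    then have w: "w' = w" using w' assms(4) by (simp add: list_encode_eq)
    have "prefix (apply_listed (pre q n) u) (g u)"
      using apply_listed_cases[OF q, of n u] g by (auto dest: monotone_word_funD)
    moreover have "prefix (g w) (g u)" using g assms(5) monotone_word_funD by blast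
    ultimately have "prefix (apply_listed (pre q n) u) (g w) \<or> prefix (g w) (apply_listed (pre q n) u)"
      using prefix_same_cases by blast
    then show ?thesis using assms(5) by (auto simp: step w extend_def)
  qed
qed simp

section \<open>Evaluation of \<open>Phi\<close> through finite approximations\<close>

lemma Phi_eq_word_fun_sup:
  assumes "monotone_word_fun g" "lists_graph q g"
  shows "Phi q = word_fun_sup g"
proof -
  have "(THE g. lists_graph q g) = g" using assms(2) lists_graph_unique by blast
  then have "Phi q p = word_fun_sup g p" for p using assms by (auto simp: Phi_def)
  then show ?thesis by blast
qed

lemma Phi_SomeD:
  assumes "Phi q p = Some r"
  obtains g where "monotone_word_fun g" "lists_graph q g" "word_fun_sup g p = Some r"
proof -
  obtain g where "monotone_word_fun g" "lists_graph q g"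
    using assms unfolding Phi_def by (auto split: if_splits)
  then show ?thesis using assms that Phi_eq_word_fun_sup by metis
qed

text \<open>Listing and argument are approximated at once. A value found at stage \<open>m\<close>
  comes from an entry that remains visible, so the outputs form a chain; it is unbounded since every
  pair of the graph is listed eventually.\<close>

lemma approximates_Phi:
  assumes Phi: "Phi q p = Some r" and s: "approximates s p"
  shows "approximates (\<lambda>n. apply_listed (pre q n) (s n)) r"
proof -
  obtain g where g: "monotone_word_fun g" "lists_graph q g" and r: "word_fun_sup g p = Some r"
    using Phi by (rule Phi_SomeD)
  have gs: "approximates (\<lambda>n. g (s n)) r"
    by (rule approximates_word_fun[OF g(1) r s])
  let ?a = "\<lambda>n. apply_listed (pre q n) (s n)"
  show ?thesis
    unfolding approximates_def
  proof (intro conjI allI impI)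
    fix m n :: nat
    assume "m \<le> n"
    then have "prefix (s m) (s n)" by (rule approximatesD(1)[OF s])
    show "prefix (?a m) (?a n)"
    proof (cases "?a m = []")
      case False
      then obtain i w where "i < m" "q i = prod_encode (list_encode w, list_encode (g w))"
        "prefix w (s m)" "?a m = g w"
        using apply_listed_cases[OF g(2), of m "s m"] by blast
      then show ?thesis
        using prefix_apply_listed[OF g, of i n w "s n"] \<open>m \<le> n\<close> \<open>prefix (s m) (s n)\<close>
          prefix_order.trans by auto
    qed simp
  next
    fix n
    have "prefix (?a n) (g (s n))"
      using apply_listed_cases[OF g(2), of n "s n"] g(1) by (auto dest: monotone_word_funD)
    then show "?a n \<sqsubset>\<^sub>B r" using approximatesD(2)[OF gs] initial_prefix_trans by blast
  next
    fix m
    obtain n where n: "m \<le> length (g (s n))" using approximatesD(4)[OF gs] by blast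
    have "prod_encode (list_encode (s n), list_encode (g (s n))) \<in> range q"
      using g(2) unfolding lists_graph_def by blast
    then obtain i where i: "q i = prod_encode (list_encode (s n), list_encode (g (s n)))"
      by auto
    \<comment> \<open>Entry \<open>i\<close> occurs in \<open>pre q n\<close> only for
      \<open>n > i\<close>, whence \<open>Suc i\<close>.\<close>
    have "prefix (g (s n)) (?a (max n (Suc i)))"
      using approximatesD(1)[OF s, of n "max n (Suc i)"] prefix_apply_listed[OF g _ i] by auto
    then show "\<exists>n. m \<le> length (?a n)" using n prefix_length_le le_trans by blast
  qed
qed

text \<open>Position \<open>k\<close> is reserved for the word with code \<open>k\<close>, so each
  entry depends on \<open>h\<close> at one known word.\<close>

definition graph_listing :: "(nat list \<Rightarrow> nat list) \<Rightarrow> baire" where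
  "graph_listing h k = prod_encode (k, list_encode (h (list_decode k)))"

lemma Phi_graph_listing:
  assumes "monotone_word_fun h"
  shows "Phi (graph_listing h) = word_fun_sup h"
proof (rule Phi_eq_word_fun_sup[OF assms])
  have "range (graph_listing h) = (\<lambda>w. graph_listing h (list_encode w)) ` UNIV"
    using surj_list_encode by (metis image_image)
  then show "lists_graph (graph_listing h) h"
    by (simp add: lists_graph_def graph_listing_def)
qed

text \<open>Makes the code of a word usable as a stage that grows with the word, as in
  \<open>constant_index\<close>.\<close>

lemma prefix_list_encode_le: "prefix v w \<Longrightarrow> list_encode v \<le> list_encode w"
proof (induction v arbitrary: w)
  case (Cons x v)
  then obtain w' where w: "w = x # w'" "prefix v w'" by (cases w) auto
  have "prod_encode (x, a) \<le> prod_encode (x, b)" if "a \<le> b" for a b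
    using that by (induction rule: dec_induct) (auto simp: prod_encode_def)
  with Cons w show ?case by simp
qed simp

section \<open>Continuous partial functions\<close>

lemma open_cylinder: "open {p :: baire. pre p n = w}"
proof (cases "length w = n")
  case True
  have "open ((\<lambda>p :: baire. p i) -` {w ! i})" for i
    by (rule open_vimage) (auto simp: open_discrete)
  then have "open (\<Inter>i\<in>{..<n}. (\<lambda>p :: baire. p i) -` {w ! i})" by blast
  moreover have "{p. pre p n = w} = (\<Inter>i\<in>{..<n}. (\<lambda>p. p i) -` {w ! i})"
    using True by (auto simp: list_eq_iff_nth_eq)
  ultimately show ?thesis by simp
next
  case False
  then have "{p. pre p n = w} = {}" by auto
  then show ?thesis by (simp only: open_empty)
qed

text \<open>A basic open set of the product topology restricts finitely many coordinates; agreement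
  on a segment reaching past all of them ensures membership.\<close>

lemma open_contains_cylinder:
  assumes "open A" "p \<in> A"
  shows "\<exists>n. \<forall>p' :: baire. pre p' n = pre p n \<longrightarrow> p' \<in> A"
proof -
  obtain X where X: "p \<in> PiE UNIV X" "finite {i. X i \<noteq> UNIV}" "PiE UNIV X \<subseteq> A"
    using product_topology_open_contains_basis[of "\<lambda>_. euclidean :: nat topology" UNIV A p] assms
    by (auto simp: open_fun_def)
  then obtain n where n: "\<forall>i\<in>{i. X i \<noteq> UNIV}. i < n"
    using finite_nat_set_iff_bounded by blast
  have "p' \<in> PiE UNIV X" if "pre p' n = pre p n" for p'
  proof -
    have "p' i \<in> X i" for i
      using X(1) n that by (cases "i < n") (auto simp: pre_eq_iff PiE_iff)
    then show ?thesis by auto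
  qed
  then show ?thesis using X(3) by blast
qed

lemma continuous_on_baire_iff:
  fixes F :: "baire \<Rightarrow> baire"
  shows "continuous_on S F \<longleftrightarrow>
    (\<forall>p\<in>S. \<forall>m. \<exists>n. \<forall>p'\<in>S. pre p' n = pre p n \<longrightarrow> pre (F p') m = pre (F p) m)"
proof
  assume F: "continuous_on S F"
  show "\<forall>p\<in>S. \<forall>m. \<exists>n. \<forall>p'\<in>S. pre p' n = pre p n \<longrightarrow> pre (F p') m = pre (F p) m"
  proof (intro ballI allI)
    fix p m
    assume "p \<in> S"
    then obtain A where "open A" "p \<in> A" "\<forall>y\<in>S. y \<in> A \<longrightarrow> F y \<in> {r. pre r m = pre (F p) m}"
      using F open_cylinder[of m "pre (F p) m"] unfolding continuous_on_topological by blast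
    then show "\<exists>n. \<forall>p'\<in>S. pre p' n = pre p n \<longrightarrow> pre (F p') m = pre (F p) m"
      using open_contains_cylinder[of A p] by blast
  qed
next
  assume F: "\<forall>p\<in>S. \<forall>m. \<exists>n. \<forall>p'\<in>S. pre p' n = pre p n \<longrightarrow> pre (F p') m = pre (F p) m"
  show "continuous_on S F"
    unfolding continuous_on_topological
  proof (intro ballI allI impI)
    fix p B
    assume p: "p \<in> S" and "open B" "F p \<in> B"
    then obtain m where m: "\<forall>r. pre r m = pre (F p) m \<longrightarrow> r \<in> B"
      using open_contains_cylinder by blast
    obtain n where "\<forall>p'\<in>S. pre p' n = pre p n \<longrightarrow> pre (F p') m = pre (F p) m"
      using F p by blast
    with m show "\<exists>A. open A \<and> p \<in> A \<and> (\<forall>y\<in>S. y \<in> A \<longrightarrow> F y \<in> B)"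
      by (intro exI[of _ "{p'. pre p' n = pre p n}"]) (auto simp: open_cylinder)
  qed
qed

lemma continuous_word_fun_sup:
  assumes h: "monotone_word_fun h" and F: "\<forall>p\<in>dom F. F p = word_fun_sup h p"
  shows "continuous_fun F"
  unfolding continuous_fun_def continuous_on_baire_iff
proof (intro ballI allI)
  have appr: "approximates (\<lambda>n. h (pre p n)) (the (F p))" if "p \<in> dom F" for p
    using F that word_fun_sup_eq_Some_iff[OF h, of p "the (F p)"] by (metis domD option.sel)
  fix p m
  assume p: "p \<in> dom F"
  obtain n where n: "m \<le> length (h (pre p n))" using approximatesD(4)[OF appr[OF p]] by blast
  have *: "pre (the (F p')) m = take m (h (pre p' n))" if "p' \<in> dom F" "pre p' n = pre p n" for p'
    using approximatesD(3)[OF appr[OF that(1)], of n] n that(2) by (metis min_absorb1 take_pre)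
  show "\<exists>n. \<forall>p'\<in>dom F. pre p' n = pre p n \<longrightarrow> pre (the (F p')) m = pre (the (F p)) m"
    using * p by (intro exI[of _ n]) auto
qed

text \<open>On input \<open>w\<close>, output the longest segment, up to the length of
  \<open>w\<close>, shared by the values of \<open>F\<close> at all points of its domain extending
  \<open>w\<close>. Continuity at \<open>p\<close> makes these segments grow without bound along
  \<open>p\<close>.\<close>

lemma continuous_fun_word_fun:
  assumes F: "continuous_fun F"
  shows "\<exists>h. monotone_word_fun h \<and> (\<forall>p\<in>dom F. F p = word_fun_sup h p)"
proof -
  define ext where "ext w = {p \<in> dom F. w \<sqsubset>\<^sub>B p}" for w
  \<comment> \<open>The bound \<open>length w\<close> guarantees a greatest \<open>m\<close> even
    when \<open>ext w\<close> is empty or a single point.\<close>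
  define agree where "agree w m \<longleftrightarrow> m \<le> length w \<and>
    (\<forall>p\<in>ext w. \<forall>p'\<in>ext w. pre (the (F p)) m = pre (the (F p')) m)" for w m
  \<comment> \<open>If \<open>ext w\<close> is empty, the chosen point is arbitrary and
    \<open>c\<close> may break monotonicity; \<open>monotonise\<close> repairs this without changing
    \<open>c\<close> along points of the domain.\<close>
  define c where "c w = pre (the (F (SOME p. p \<in> ext w))) (GREATEST m. agree w m)" for w
  have agree: "agree w (GREATEST m. agree w m)" for w
    by (rule GreatestI_nat[where k = 0 and b = "length w"]) (auto simp: agree_def)
  have le: "m \<le> (GREATEST m. agree w m)" if "agree w m" for w m
    using that by (rule Greatest_le_nat[where b = "length w"]) (auto simp: agree_def)
  have c: "c w = pre (the (F p)) (GREATEST m. agree w m)" if "p \<in> ext w" for p w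
    using agree[of w] someI[of "\<lambda>p. p \<in> ext w", OF that] that
    unfolding c_def agree_def by blast
  have "F p = word_fun_sup (monotonise c) p" if p: "p \<in> dom F" for p
  proof -
    have p_ext: "p \<in> ext (pre p n)" for n using p by (simp add: ext_def)
    let ?l = "\<lambda>n. GREATEST m. agree (pre p n) m"
    have cp: "c (pre p n) = pre (the (F p)) (?l n)" for n by (rule c[OF p_ext])
    have l_mono: "?l m \<le> ?l n" if "m \<le> n" for m n
    proof (rule le)
      have "ext (pre p n) \<subseteq> ext (pre p m)"
        using prefix_pre[OF that] initial_prefix_trans by (auto simp: ext_def)
      then show "agree (pre p n) (?l m)"
        using agree[of "pre p m"] that unfolding agree_def by auto
    qed
    have "\<exists>n. m \<le> ?l n" for m
    proof -
      obtain n where n: "\<forall>p'\<in>dom F. pre p' n = pre p n \<longrightarrow> pre (the (F p')) m = pre (the (F p)) m"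
        using F p unfolding continuous_fun_def continuous_on_baire_iff by blast
      have "pre p' n = pre p n" if "p' \<in> ext (pre p (max m n))" for p'
      proof -
        have "pre p' (max m n) = pre p (max m n)" using that by (auto simp: ext_def initial_iff_pre)
        then show ?thesis by (auto simp: pre_eq_iff)
      qed
      then have "agree (pre p (max m n)) m"
        using n unfolding agree_def by (auto simp: ext_def)
      then show ?thesis using le by blast
    qed
    then have "approximates (\<lambda>n. c (pre p n)) (the (F p))"
      unfolding cp by (intro approximates_reindex[OF approximates_pre] l_mono)
    moreover from this have "monotonise c (pre p n) = c (pre p n)" for n
      using approximatesD(1) by (intro monotonise_eq) blast
    ultimately have "word_fun_sup (monotonise c) p = Some (the (F p))"
      by (simp add: word_fun_sup_eq_Some_iff monotone_monotonise)
    then show ?thesis using p by auto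
  qed
  then show ?thesis using monotone_monotonise by blast
qed

section \<open>Discontinuous problems compute DIS\<close>

text \<open>The listed function uses its input only as a stage, namely its code. With the code
  instead of the length, entry \<open>k\<close> is computed from the first \<open>k\<close> values
  of both halves of \<open>p\<close>, without decoding \<open>k\<close>.\<close>

definition constant_index :: "baire \<Rightarrow> baire" where
  "constant_index p =
    graph_listing (\<lambda>w. apply_listed (pre (bfst p) (list_encode w)) (pre (bsnd p) (list_encode w)))"

lemma Phi_constant_index:
  assumes "U p = Some r"
  shows "Phi (constant_index p) x = Some r"
proof -
  let ?s = "\<lambda>n. apply_listed (pre (bfst p) n) (pre (bsnd p) n)"
  have s: "approximates ?s r"
    using assms by (intro approximates_Phi[OF _ approximates_pre]) (simp add: U_def)
  have mono: "monotone_word_fun (\<lambda>w. ?s (list_encode w))"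
    using approximatesD(1)[OF s] prefix_list_encode_le
    by (simp add: monotone_word_fun_def monotone_def)
  have "m \<le> list_encode (pre x m)" for m
    using length_le_list_encode[of "pre x m"] by simp
  then have "approximates (\<lambda>n. ?s (list_encode (pre x n))) r"
    by (intro approximates_reindex[OF s] prefix_list_encode_le prefix_pre) auto
  then show ?thesis
    unfolding constant_index_def Phi_graph_listing[OF mono] word_fun_sup_eq_Some_iff[OF mono] .
qed

definition constant_index_word :: "nat list \<Rightarrow> nat list" where
  "constant_index_word w = map (\<lambda>k. prod_encode (k, list_encode
     (apply_listed (take k (evens w)) (take k (odds w))))) [0..<length w div 2]"

lemma constant_index_word_pre:
  "constant_index_word (pre p n) = pre (constant_index p) (n div 2)"
  unfolding constant_index_word_def pre_def[of "constant_index p"]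
  by (auto simp: constant_index_def graph_listing_def evens_pre odds_pre)

lemma monotone_constant_index_word: "monotone_word_fun constant_index_word"
  by (rule monotone_word_funI) (auto simp: constant_index_word_pre intro: prefix_pre div_le_mono)

lemma word_fun_sup_constant_index_word:
  "word_fun_sup constant_index_word p = Some (constant_index p)"
proof -
  have "\<exists>n. m \<le> n div 2" for m :: nat by (rule exI[of _ "2 * m"]) simp
  then show ?thesis
    unfolding word_fun_sup_eq_Some_iff[OF monotone_constant_index_word] constant_index_word_pre
    by (intro approximates_reindex[OF approximates_pre]) (auto intro: div_le_mono)
qed

lemma recursive_constant_index_word: "recursive constant_index_word"
  unfolding constant_index_word_def by (intro recursive_intros)

lemma continuous_constant_index: "continuous_on UNIV constant_index"
  using continuous_word_fun_sup[OF monotone_constant_index_word, of "\<lambda>p. Some (constant_index p)"]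
  by (simp add: continuous_fun_def word_fun_sup_constant_index_word dom_def)

text \<open>The class of admissible functions stays abstract, so both the computable and the
  continuous case are covered. Postprocessing is the identity \<open>Some\<close>, which makes the
  reduction strong.\<close>

lemma sW_reducible_of_discontinuous:
  assumes D: "\<And>q. \<exists>x. \<delta>X (D q) = Some x \<and> x \<in> mv_dom f \<and>
      (\<forall>y. (\<delta>Y \<circ>\<^sub>m Phi q) (D q) = Some y \<longrightarrow> y \<notin> f x)"
    and C: "\<C> Some" "\<C> (\<lambda>p. Some (D (constant_index p)))"
  shows "sW_reducible_in \<C> Some Some DIS \<delta>X \<delta>Y f"
  unfolding sW_reducible_in_def
proof (intro exI conjI allI impI)
  fix G
  assume G: "realizer \<delta>X \<delta>Y f G"
  show "realizer Some Some DIS (Some \<circ>\<^sub>m G \<circ>\<^sub>m (\<lambda>p. Some (D (constant_index p))))"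
    unfolding realizer_def
  proof (intro allI impI)
    fix p x
    assume "Some p = Some x \<and> x \<in> mv_dom DIS"
    then have x: "x = p" by simp
    let ?d = "D (constant_index p)"
    obtain z where z: "\<delta>X ?d = Some z" "z \<in> mv_dom f"
      and no: "\<And>y. (\<delta>Y \<circ>\<^sub>m Phi (constant_index p)) ?d = Some y \<Longrightarrow> y \<notin> f z"
      using D by blast
    obtain y where y: "(\<delta>Y \<circ>\<^sub>m G) ?d = Some y" "y \<in> f z"
      using G z unfolding realizer_def by blast
    then obtain r where r: "G ?d = Some r" "\<delta>Y r = Some y"
      by (auto simp: map_comp_def split: option.splits)
    \<comment> \<open>If \<open>U p\<close> were \<open>r\<close>, the index would make
      \<open>Phi\<close> return \<open>r\<close> at \<open>?d\<close>, although \<open>r\<close>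
      names a correct answer. For undefined \<open>U p\<close> the claim holds whatever the index
      lists.\<close>
    have "U p \<noteq> Some r"
      using no[of y] y(2) r Phi_constant_index[of p r ?d] by auto
    then show "\<exists>y. (Some \<circ>\<^sub>m (Some \<circ>\<^sub>m G \<circ>\<^sub>m (\<lambda>p. Some (D (constant_index p))))) p = Some y \<and> y \<in> DIS x"
      using r x by (auto simp: DIS_def map_comp_def)
  qed
qed (use C in auto)

section \<open>Problems computing DIS are discontinuous\<close>

definition pair_word :: "baire \<Rightarrow> nat list \<Rightarrow> nat list" where
  "pair_word a w = interleave (pre a (length w)) w"

lemma monotone_pair_word: "monotone_word_fun (pair_word a)"
  by (rule monotone_word_funI) (simp add: pair_word_def interleave_pre prefix_pre)

lemma word_fun_sup_pair_word: "word_fun_sup (pair_word a) q = Some (bpair a q)"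
  unfolding word_fun_sup_eq_Some_iff[OF monotone_pair_word] pair_word_def length_pre
  by (intro approximates_interleave approximates_pre)

lemma recursive_pair_word:
  assumes "recursive a"
  shows "recursive (pair_word a)"
  unfolding pair_word_def pre_def by (intro recursive_intros recursive_comp[OF assms])

text \<open>Entry \<open>n\<close> of a listing may depend on the earlier entries of the same listing, and a word
  coded by \<open>n\<close> has length at most \<open>n\<close>.  Hence the index may be used, up to that length, in the
  word function that it lists, and the fixed point arises by course-of-values recursion.\<close>

lemma self_referential_listing:
  fixes C :: "nat list \<Rightarrow> nat list \<Rightarrow> nat list"
  obtains a where "a = graph_listing (monotonise (\<lambda>w. C (pre a (length w)) w))"
    "recursive (\<lambda>z. C (fst z) (snd z)) \<Longrightarrow> recursive a"
proof
  \<comment> \<open>\<open>e l n\<close> computes entry \<open>n\<close> from the list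
    \<open>l\<close> of all earlier entries, which \<open>A n\<close> accumulates.\<close>
  define e where "e l n = prod_encode (n, list_encode
    (monotonise (\<lambda>w. C (take (length w) l) w) (list_decode n)))" for l n
  define A where "A n = rec_nat [] (\<lambda>n l. l @ [e l n]) n" for n
  define a where "a n = e (A n) n" for n
  have A: "A n = pre a n" for n
    by (induction n) (simp_all add: A_def a_def pre_Suc)
  show "a = graph_listing (monotonise (\<lambda>w. C (pre a (length w)) w))"
  proof
    fix n
    have "monotonise (\<lambda>w. C (take (length w) (pre a n)) w) (list_decode n) =
        monotonise (\<lambda>w. C (pre a (length w)) w) (list_decode n)"
    proof (rule monotonise_cong)
      fix v
      assume "prefix v (list_decode n)"
      then have "length v \<le> n"
        using prefix_length_le length_le_list_encode[of "list_decode n"] by fastforce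
      then show "C (take (length v) (pre a n)) v = C (pre a (length v)) v" by simp
    qed
    then show "a n = graph_listing (monotonise (\<lambda>w. C (pre a (length w)) w)) n"
      by (simp add: a_def e_def A graph_listing_def)
  qed
  show "recursive a" if C: "recursive (\<lambda>z. C (fst z) (snd z))"
    unfolding a_def A_def e_def by (intro recursive_intros recursive_comp2[OF C])
qed

text \<open>The value of \<open>U\<close> is asserted only where the whole computation converges.
  For other \<open>q\<close> the approximations may fail to form a chain, and
  \<open>monotonise\<close> keeps the index consistent.\<close>

lemma universal_fixed_point:
  assumes h: "monotone_word_fun h" and k: "monotone_word_fun k"
  shows "\<exists>a. (\<forall>q p r z. word_fun_sup k (bpair a q) = Some p \<longrightarrow> Phi q p = Some r \<longrightarrow>
      word_fun_sup h (bpair (bpair a q) r) = Some z \<longrightarrow> U (bpair a q) = Some z) \<and>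
    (recursive h \<longrightarrow> recursive k \<longrightarrow> recursive a)"
proof -
  \<comment> \<open>Here \<open>v\<close> approximates the index \<open>a\<close>, and
    \<open>w\<close> approximates \<open>q\<close>, both as an argument and as a listing. The
    nesting imitates \<open>H\<close> on the pair of \<open>bpair a q\<close> and
    \<open>Phi q (K (bpair a q))\<close>.\<close>
  define C where "C v w = h (interleave (interleave v w) (apply_listed w (k (interleave v w))))" for v w
  obtain a where a: "a = graph_listing (monotonise (\<lambda>w. C (pre a (length w)) w))"
    and rec: "recursive (\<lambda>z. C (fst z) (snd z)) \<Longrightarrow> recursive a"
    using self_referential_listing[of C] by blast
  let ?c = "\<lambda>w. C (pre a (length w)) w"
  show ?thesis
  proof (intro exI conjI allI impI)
    fix q p r z
    assume p: "word_fun_sup k (bpair a q) = Some p" and r: "Phi q p = Some r"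
      and z: "word_fun_sup h (bpair (bpair a q) r) = Some z"
    let ?s = "\<lambda>n. interleave (pre a n) (pre q n)"
    have s: "approximates ?s (bpair a q)"
      by (intro approximates_interleave approximates_pre)
    have "approximates (\<lambda>n. h (interleave (?s n) (apply_listed (pre q n) (k (?s n))))) z"
      by (intro approximates_word_fun[OF h z] approximates_interleave s approximates_Phi[OF r]
          approximates_word_fun[OF k p])
    then have c: "approximates (\<lambda>n. ?c (pre q n)) z" by (simp add: C_def)
    then have "monotonise ?c (pre q n) = ?c (pre q n)" for n
      using approximatesD(1) by (intro monotonise_eq) blast
    with c have "word_fun_sup (monotonise ?c) q = Some z"
      by (simp add: word_fun_sup_eq_Some_iff monotone_monotonise)
    moreover have "Phi a = word_fun_sup (monotonise ?c)"
      using arg_cong[OF a, of Phi] Phi_graph_listing[OF monotone_monotonise] by (rule trans)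
    ultimately show "U (bpair a q) = Some z" by (simp add: U_def)
  next
    assume "recursive h" "recursive k"
    show "recursive a"
      by (rule rec, unfold C_def)
        (intro recursive_intros recursive_comp[OF \<open>recursive h\<close>] recursive_comp[OF \<open>recursive k\<close>])
  qed
qed

text \<open>The reduction works for every realizer, so a given one may be altered at a single point
  \<open>d\<close>, the value of \<open>K\<close>. Since \<open>K\<close> does not involve the
  realizer, the altered one is still queried at \<open>d\<close>.\<close>

lemma instance_of_W_reduction:
  assumes ex: "realizer \<delta>X \<delta>Y f G"
    and red: "\<And>G. realizer \<delta>X \<delta>Y f G \<Longrightarrow>
      realizer Some Some DIS (\<lambda>p. Option.bind ((G \<circ>\<^sub>m K) p) (\<lambda>r. H (bpair p r)))"
    and a: "\<And>q p r z. K (bpair a q) = Some p \<Longrightarrow> Phi q p = Some r \<Longrightarrow>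
      H (bpair (bpair a q) r) = Some z \<Longrightarrow> U (bpair a q) = Some z"
  shows "\<exists>d x. K (bpair a q) = Some d \<and> \<delta>X d = Some x \<and> x \<in> mv_dom f \<and>
    (\<forall>y. (\<delta>Y \<circ>\<^sub>m Phi q) d = Some y \<longrightarrow> y \<notin> f x)"
proof -
  let ?p = "bpair a q"
  have DIS: "?p \<in> mv_dom DIS"
  proof (cases "U ?p")
    case (Some r)
    then have "(\<lambda>n. Suc (r n)) \<in> DIS ?p" by (simp add: DIS_def fun_eq_iff)
    then show ?thesis by (auto simp: mv_dom_def)
  qed (simp add: mv_dom_def DIS_def)
  have step: "\<exists>d r z. K ?p = Some d \<and> G d = Some r \<and> H (bpair ?p r) = Some z \<and> U ?p \<noteq> Some z"
    if real: "realizer \<delta>X \<delta>Y f G" for G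
  proof -
    obtain z where z: "(Some \<circ>\<^sub>m (\<lambda>p. Option.bind ((G \<circ>\<^sub>m K) p) (\<lambda>r. H (bpair p r)))) ?p = Some z"
      "z \<in> DIS ?p"
      using red[OF real] DIS unfolding realizer_def by blast
    then show ?thesis
      by (auto simp: map_comp_Some_iff bind_eq_Some_conv DIS_def)
  qed
  obtain d where d: "K ?p = Some d" using step[OF ex] by blast
  have "\<exists>x. \<delta>X d = Some x \<and> x \<in> mv_dom f"
  proof (rule ccontr)
    assume "\<not> ?thesis"
    \<comment> \<open>If \<open>d\<close> names no instance, a realizer may be undefined there; but
      then the reduction has no output at \<open>?p\<close>.\<close>
    then have real: "realizer \<delta>X \<delta>Y f (G(d := None))"
      using ex by (auto simp: realizer_def map_comp_def)
    show False using step[OF real] d by auto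
  qed
  then obtain x where x: "\<delta>X d = Some x" "x \<in> mv_dom f" by blast
  have "y \<notin> f x" if "(\<delta>Y \<circ>\<^sub>m Phi q) d = Some y" for y
  proof
    assume "y \<in> f x"
    \<comment> \<open>A realizer may return a correct answer \<open>Phi q d\<close> at
      \<open>d\<close>; from it \<open>H\<close> produces the value that the fixed point has made
      equal to \<open>U ?p\<close>.\<close>
    then have real: "realizer \<delta>X \<delta>Y f (G(d := Phi q d))"
      using ex that x by (auto simp: realizer_def map_comp_def)
    obtain r z where "Phi q d = Some r" "H (bpair ?p r) = Some z" "U ?p \<noteq> Some z"
      using step[OF real] d by auto
    then show False using a[OF d] by blast
  qed
  then show ?thesis using d x by blast
qed

lemma W_reducible_of_sW_reducible:
  assumes "sW_reducible_in \<C> Some Some DIS \<delta>X \<delta>Y f" "\<And>H. \<C> H \<Longrightarrow> \<C> (\<lambda>p. H (bsnd p))"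
  shows "W_reducible_in \<C> Some Some DIS \<delta>X \<delta>Y f"
proof -
  obtain H K where HK: "\<C> H" "\<C> K"
    and red: "\<And>G. realizer \<delta>X \<delta>Y f G \<Longrightarrow> realizer Some Some DIS (H \<circ>\<^sub>m G \<circ>\<^sub>m K)"
    using assms(1) unfolding sW_reducible_in_def by blast
  have "(\<lambda>p. Option.bind ((G \<circ>\<^sub>m K) p) (\<lambda>r. H (bsnd (bpair p r)))) = H \<circ>\<^sub>m G \<circ>\<^sub>m K" for G
    by (auto simp: map_comp_def fun_eq_iff split: option.splits)
  then show ?thesis
    unfolding W_reducible_in_def
    using HK assms(2) red by (intro exI[of _ "\<lambda>p. H (bsnd p)"] exI[of _ K]) auto
qed

section \<open>Closure of the two classes under composition\<close>

lemma computable_funI: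
  assumes "monotone_word_fun h" "recursive h" "\<And>p. p \<in> dom F \<Longrightarrow> F p = word_fun_sup h p"
  shows "computable_fun F"
  using assms unfolding computable_fun_def computable_word_fun_iff_recursive by blast

lemma computable_funE:
  assumes "computable_fun F"
  obtains h where "monotone_word_fun h" "recursive h" "\<And>p. p \<in> dom F \<Longrightarrow> F p = word_fun_sup h p"
  using assms unfolding computable_fun_def computable_word_fun_iff_recursive by blast

lemma computable_fun_comp:
  assumes "computable_fun F" "monotone_word_fun g" "recursive g" "\<And>p. word_fun_sup g p = Some (s p)"
  shows "computable_fun (\<lambda>p. F (s p))"
proof -
  obtain h where h: "monotone_word_fun h" "recursive h"
    "\<And>p. p \<in> dom F \<Longrightarrow> F p = word_fun_sup h p"
    using computable_funE[OF assms(1)] by blast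
  show ?thesis
  proof (rule computable_funI[OF monotone_word_fun_comp[OF h(1) assms(2)] recursive_comp[OF h(2) assms(3)]])
    fix p
    assume "p \<in> dom (\<lambda>p. F (s p))"
    then obtain r where r: "F (s p) = Some r" by blast
    then have "word_fun_sup h (s p) = Some r" using h(3)[of "s p"] by force
    then show "F (s p) = word_fun_sup (\<lambda>w. h (g w)) p"
      using word_fun_sup_comp[OF h(1) assms(2,4)] r by simp
  qed
qed

lemma continuous_fun_comp:
  assumes "continuous_fun F" "continuous_on UNIV s"
  shows "continuous_fun (\<lambda>p. F (s p))"
proof -
  have "continuous_on (dom (\<lambda>p. F (s p))) (\<lambda>p. the (F (s p)))"
    by (rule continuous_on_compose2[OF assms(1)[unfolded continuous_fun_def]
          continuous_on_subset[OF assms(2) subset_UNIV]]) auto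
  then show ?thesis by (simp add: continuous_fun_def)
qed

lemma continuous_bpair: "continuous_on UNIV (bpair a)"
  unfolding continuous_on_baire_iff
proof (intro ballI allI)
  fix q m
  have "pre (bpair a q') m = pre (bpair a q) m" if "pre q' m = pre q m" for q'
    using that by (auto simp: pre_eq_iff bpair_def)
  then show "\<exists>n. \<forall>q'\<in>UNIV. pre q' n = pre q n \<longrightarrow> pre (bpair a q') m = pre (bpair a q) m" by blast
qed

lemma continuous_bsnd: "continuous_on UNIV bsnd"
  unfolding bsnd_def by (intro continuous_on_coordinatewise_then_product continuous_on_product_coordinates)

text \<open>Hypothesis \<open>fp\<close> is the recursion theorem for the class. The witness maps
  \<open>q\<close> to \<open>K (bpair a q)\<close>; it is total because an instance is obtained for
  every \<open>q\<close>.\<close>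

lemma discontinuous_of_fixed_points:
  assumes "problem X \<delta>X Y \<delta>Y f" "W_reducible_in \<C> Some Some DIS \<delta>X \<delta>Y f"
    and fp: "\<And>H K. \<C> H \<Longrightarrow> \<C> K \<Longrightarrow> \<exists>a. \<C> (\<lambda>q. K (bpair a q)) \<and>
      (\<forall>q p r z. K (bpair a q) = Some p \<longrightarrow> Phi q p = Some r \<longrightarrow>
        H (bpair (bpair a q) r) = Some z \<longrightarrow> U (bpair a q) = Some z)"
  shows "discontinuous_in \<C> \<delta>X \<delta>Y f"
proof -
  obtain G where G: "realizer \<delta>X \<delta>Y f G" using assms(1) unfolding problem_def by blast
  obtain H K where "\<C> H" "\<C> K"
    and red: "\<And>G. realizer \<delta>X \<delta>Y f G \<Longrightarrow>
      realizer Some Some DIS (\<lambda>p. Option.bind ((G \<circ>\<^sub>m K) p) (\<lambda>r. H (bpair p r)))"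
    using assms(2) unfolding W_reducible_in_def by blast
  then obtain a where K: "\<C> (\<lambda>q. K (bpair a q))"
    and a: "\<And>q p r z. K (bpair a q) = Some p \<Longrightarrow> Phi q p = Some r \<Longrightarrow>
      H (bpair (bpair a q) r) = Some z \<Longrightarrow> U (bpair a q) = Some z"
    using fp[of H K] by blast
  have "\<exists>d x. K (bpair a q) = Some d \<and> \<delta>X d = Some x \<and> x \<in> mv_dom f \<and>
      (\<forall>y. (\<delta>Y \<circ>\<^sub>m Phi q) d = Some y \<longrightarrow> y \<notin> f x)" for q
    by (rule instance_of_W_reduction[OF G red a])
  then obtain D where D: "\<And>q. K (bpair a q) = Some (D q)"
    "\<And>q. \<exists>x. \<delta>X (D q) = Some x \<and> x \<in> mv_dom f \<and>
      (\<forall>y. (\<delta>Y \<circ>\<^sub>m Phi q) (D q) = Some y \<longrightarrow> y \<notin> f x)"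
    by metis
  then have "\<C> (\<lambda>q. Some (D q))" using K by simp
  then show ?thesis unfolding discontinuous_in_def using D(2) by blast
qed

text \<open>Recursiveness of the index makes \<open>pair_word a\<close> recursive, and hence
  \<open>K (bpair a q)\<close> computable in \<open>q\<close>.\<close>

lemma computable_fixed_point:
  assumes H: "computable_fun H" and K: "computable_fun K"
  shows "\<exists>a. computable_fun (\<lambda>q. K (bpair a q)) \<and>
    (\<forall>q p r z. K (bpair a q) = Some p \<longrightarrow> Phi q p = Some r \<longrightarrow>
      H (bpair (bpair a q) r) = Some z \<longrightarrow> U (bpair a q) = Some z)"
proof -
  obtain h where h: "monotone_word_fun h" "recursive h" "\<And>p. p \<in> dom H \<Longrightarrow> H p = word_fun_sup h p"
    using computable_funE[OF H] by blast
  obtain k where k: "monotone_word_fun k" "recursive k" "\<And>p. p \<in> dom K \<Longrightarrow> K p = word_fun_sup k p"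
    using computable_funE[OF K] by blast
  obtain a where a: "\<And>q p r z. word_fun_sup k (bpair a q) = Some p \<Longrightarrow> Phi q p = Some r \<Longrightarrow>
      word_fun_sup h (bpair (bpair a q) r) = Some z \<Longrightarrow> U (bpair a q) = Some z"
    and rec: "recursive h \<Longrightarrow> recursive k \<Longrightarrow> recursive a"
    using universal_fixed_point[OF h(1) k(1)] by blast
  have "computable_fun (\<lambda>q. K (bpair a q))"
    using computable_fun_comp[OF K monotone_pair_word recursive_pair_word[OF rec[OF h(2) k(2)]]
        word_fun_sup_pair_word] .
  moreover have "U (bpair a q) = Some z"
    if "K (bpair a q) = Some p" "Phi q p = Some r" "H (bpair (bpair a q) r) = Some z" for q p r z
    using a[of q p r z] that h(3)[OF domI[of H, OF that(3)]] k(3)[OF domI[of K, OF that(1)]] by simp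
  ultimately show ?thesis by blast
qed

lemma continuous_fixed_point:
  assumes H: "continuous_fun H" and K: "continuous_fun K"
  shows "\<exists>a. continuous_fun (\<lambda>q. K (bpair a q)) \<and>
    (\<forall>q p r z. K (bpair a q) = Some p \<longrightarrow> Phi q p = Some r \<longrightarrow>
      H (bpair (bpair a q) r) = Some z \<longrightarrow> U (bpair a q) = Some z)"
proof -
  obtain h where h: "monotone_word_fun h" "\<And>p. p \<in> dom H \<Longrightarrow> H p = word_fun_sup h p"
    using continuous_fun_word_fun[OF H] by blast
  obtain k where k: "monotone_word_fun k" "\<And>p. p \<in> dom K \<Longrightarrow> K p = word_fun_sup k p"
    using continuous_fun_word_fun[OF K] by blast
  obtain a where a: "\<And>q p r z. word_fun_sup k (bpair a q) = Some p \<Longrightarrow> Phi q p = Some r \<Longrightarrow>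
      word_fun_sup h (bpair (bpair a q) r) = Some z \<Longrightarrow> U (bpair a q) = Some z"
    using universal_fixed_point[OF h(1) k(1)] by blast
  have "U (bpair a q) = Some z"
    if "K (bpair a q) = Some p" "Phi q p = Some r" "H (bpair (bpair a q) r) = Some z" for q p r z
    using a[of q p r z] that h(2)[OF domI[of H, OF that(3)]] k(2)[OF domI[of K, OF that(1)]] by simp
  then show ?thesis using continuous_fun_comp[OF K continuous_bpair] by blast
qed

theorem theorem17:
  fixes X :: "'x set" and Y :: "'y set"
    and \<delta>X :: "baire \<rightharpoonup> 'x" and \<delta>Y :: "baire \<rightharpoonup> 'y" and f :: "'x \<Rightarrow> 'y set"
  assumes "problem X \<delta>X Y \<delta>Y f"
  shows
    "(W_reducible Some Some DIS \<delta>X \<delta>Y f \<longleftrightarrow> computably_discontinuous \<delta>X \<delta>Y f) \<and>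
     (W_reducible_cont Some Some DIS \<delta>X \<delta>Y f \<longleftrightarrow> effectively_discontinuous \<delta>X \<delta>Y f) \<and>
     (sW_reducible Some Some DIS \<delta>X \<delta>Y f \<longleftrightarrow> computably_discontinuous \<delta>X \<delta>Y f) \<and>
     (sW_reducible_cont Some Some DIS \<delta>X \<delta>Y f \<longleftrightarrow> effectively_discontinuous \<delta>X \<delta>Y f)"
proof -
  have "computable_fun Some"
  proof (rule computable_funI)
    show "monotone_word_fun (\<lambda>w. w)" by (simp add: monotone_word_fun_def monotone_def)
    then show "Some p = word_fun_sup (\<lambda>w. w) p" for p
      using word_fun_sup_eq_Some_iff[of "\<lambda>w. w" p p] approximates_pre[of p] by simp
  qed (rule recursive_ident)
  have comp_sW: "sW_reducible Some Some DIS \<delta>X \<delta>Y f"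
    if dis: "computably_discontinuous \<delta>X \<delta>Y f"
  proof -
    obtain D where "computable_fun (\<lambda>q. Some (D q))" and D: "\<forall>q. \<exists>x. \<delta>X (D q) = Some x \<and>
        x \<in> mv_dom f \<and> (\<forall>y. (\<delta>Y \<circ>\<^sub>m Phi q) (D q) = Some y \<longrightarrow> y \<notin> f x)"
      using dis unfolding discontinuous_in_def by blast
    then have "computable_fun (\<lambda>p. Some (D (constant_index p)))"
      using computable_fun_comp[OF _ monotone_constant_index_word recursive_constant_index_word
          word_fun_sup_constant_index_word] by blast
    with D[rule_format] \<open>computable_fun Some\<close> show ?thesis by (rule sW_reducible_of_discontinuous)
  qed
  have "continuous_fun Some" by (simp add: continuous_fun_def dom_def continuous_on_id)
  have cont_sW: "sW_reducible_cont Some Some DIS \<delta>X \<delta>Y f"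
    if dis: "effectively_discontinuous \<delta>X \<delta>Y f"
  proof -
    obtain D where "continuous_fun (\<lambda>q. Some (D q))" and D: "\<forall>q. \<exists>x. \<delta>X (D q) = Some x \<and>
        x \<in> mv_dom f \<and> (\<forall>y. (\<delta>Y \<circ>\<^sub>m Phi q) (D q) = Some y \<longrightarrow> y \<notin> f x)"
      using dis unfolding discontinuous_in_def by blast
    then have "continuous_fun (\<lambda>p. Some (D (constant_index p)))"
      using continuous_fun_comp[OF _ continuous_constant_index] by blast
    with D[rule_format] \<open>continuous_fun Some\<close> show ?thesis by (rule sW_reducible_of_discontinuous)
  qed
  have comp_W: "W_reducible Some Some DIS \<delta>X \<delta>Y f" if "sW_reducible Some Some DIS \<delta>X \<delta>Y f"
    using that computable_fun_comp[OF _ monotone_word_fun_odds recursive_odds[OF recursive_ident]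
        word_fun_sup_odds]
    by (rule W_reducible_of_sW_reducible)
  have cont_W: "W_reducible_cont Some Some DIS \<delta>X \<delta>Y f" if "sW_reducible_cont Some Some DIS \<delta>X \<delta>Y f"
    using that continuous_fun_comp[OF _ continuous_bsnd] by (rule W_reducible_of_sW_reducible)
  have comp_dis: "computably_discontinuous \<delta>X \<delta>Y f" if "W_reducible Some Some DIS \<delta>X \<delta>Y f"
    using assms that computable_fixed_point by (rule discontinuous_of_fixed_points)
  have cont_dis: "effectively_discontinuous \<delta>X \<delta>Y f" if "W_reducible_cont Some Some DIS \<delta>X \<delta>Y f"
    using assms that continuous_fixed_point by (rule discontinuous_of_fixed_points)
  \<comment> \<open>For each class the implications form a cycle: discontinuity, strong
    reducibility, reducibility, discontinuity.\<close>
  show ?thesis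
    using comp_sW cont_sW comp_W cont_W comp_dis cont_dis by blast
qed

end
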